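(* Let $\Bbbk$ be a field in which every element has a square root, and let $\Gamma=(V,E)$ be a connected graph. Then there is an isomorphism of sets (a bijection) $$\Sigma/_{\cong}\;\cong\; H^1(\Gamma,\Bbbk^* )/\mathrm{Aut}(\Gamma),$$ where the right-hand side is the set of orbits of $\mathrm{Aut}(\Gamma)$ on $H^1(\Gamma,\Bbbk^* )$.
   Context: Graphs $\Gamma=(V,E)$ are finite, with no loops or multiple edges ($E$ is a set of two-element subsets of $V$). The double graph $D\Gamma$ is the quiver with vertex set $V$ and, for each $\{a,b\}\in E$, two directed edges $(a\,|\,b)$ (from $a$ to $b$) and $(b\,|\,a)$ (from $b$ to $a$). Let $E'$ be its set of directed edges. Paths in $D\Gamma$ are written $(a_1\,|\,\dots\,|\,a_n)$ (with $\{a_i,a_{i+1}\}\in E$), of length $n-1$, with $(a)$ the trivial path at $a$. The path algebra $\Bbbk D\Gamma$ has the paths as basis and multiplication by concatenation (zero if the end of the first is not the start of the second), graded by path length. A collection of skew-zigzag coefficients is a family $v=(v^a_{b,c}\in\Bbbk : \{a,b\},\{a,c\}\in E)$ with $v^a_{b,b}=1$, $v^a_{b,c}v^a_{c,b}=1$, and $v^a_{b,c}v^a_{c,d}v^a_{d,b}=1$ whenever the vertices $b,c,d$ involved are all adjacent to $a$. $\mathrm{SZC}$ is the set of all such collections. The skew-zigzag algebra $A_v(\Gamma)$ is defined as follows. If $|V|\ge 3$: $A_v(\Gamma)=\Bbbk D\Gamma/I_v$, where $I_v$ is the two-sided ideal generated by all paths $(a_1\,|\,a_2\,|\,a_3)$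 with $a_1\ne a_3$ and all $(a_1\,|\,a_2\,|\,a_1)-v^{a_1}_{a_2,a_3}(a_1\,|\,a_3\,|\,a_1)$ with $a_1$ adjacent to $a_2$ and $a_3$. If $|V|=2$: $A_v(\Gamma)$ is the quotient of $\Bbbk D\Gamma$ by the two-sided ideal generated by all paths of length greater than two. If $|V|=1$: $A_v(\Gamma)=\Bbbk[X]/(X^2)$ with $X$ in degree $2$. $A_v(\Gamma)$ is graded by path length. $\Sigma=\{A_v(\Gamma): v\in\mathrm{SZC}\}$, and $\Sigma/_{\cong}$ is the set of classes of $\Sigma$ under (arbitrary) isomorphism of graded $\Bbbk$-algebras. The space of cycles $\mathcal C$ of $\Gamma$ is the kernel of the homomorphism $\delta$ from the quotient of the free abelian group $\mathbb Z E'$ by the subgroup generated by $\{(a\,|\,b)+(b\,|\,a):\{a,b\}\in E\}$ to $\mathbb Z V$, determined by $(a\,|\,b)\mapsto a-b$. The graph cohomology is $H^1(\Gamma,\Bbbk^* )=\mathrm{Hom}_{\mathrm{group}}(\mathcal C,\Bbbk^* )$. $\mathrm{Aut}(\Gamma)$ is the group of graph automorphisms: permutations $\sigma$ of $V$ with $\{a,b\}\in E\iff\{\sigma(a),\sigma(b)\}\in E$. It acts on $\mathcal C$ via $(a\,|\,b)\mapsto(\sigma(a)\,|\,\sigma(b))$ and on $H^1(\Gamma,\Bbbk^* )$ by $(\sigma f)(C)=f(\sigma^{-1}(C))$ for $C\in\mathcal C$. *)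

theory Defs
  imports
    "HOL-Algebra.QuotRing"
    "HOL-Algebra.Module"
    "HOL-Algebra.Group_Action"
    "HOL-Algebra.Generated_Groups"
    "HOL-Algebra.Free_Abelian_Groups"
    "HOL-Combinatorics.Permutations"
    "HOL-Computational_Algebra.Polynomial"
begin

section \<open>Graphs and the paths of their double quiver\<close>

definition simple_graph :: "'v set \<Rightarrow> 'v set set \<Rightarrow> bool" where
  "simple_graph V E \<longleftrightarrow> finite V \<and> E \<subseteq> {e. e \<subseteq> V \<and> card e = 2}"

text \<open>The path \<open>(a\<^sub>1 | \<dots> | a\<^sub>n)\<close> is the nonempty list of its vertices; its length as a path is
  \<open>n - 1\<close>, and a directed edge \<open>(a | b)\<close> is the pair of its end points.\<close>

definition arcs :: "'v set set \<Rightarrow> ('v \<times> 'v) set" where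
  "arcs E = {(a, b). {a, b} \<in> E}"

definition paths :: "'v set \<Rightarrow> 'v set set \<Rightarrow> 'v list set" where
  "paths V E = {p. p \<noteq> [] \<and> set p \<subseteq> V \<and> successively (\<lambda>a b. (a, b) \<in> arcs E) p}"

definition path_length :: "'v list \<Rightarrow> nat" where
  "path_length p = length p - 1"

text \<open>The empty graph is not regarded as connected.\<close>

definition connected_graph :: "'v set \<Rightarrow> 'v set set \<Rightarrow> bool" where
  "connected_graph V E \<longleftrightarrow> simple_graph V E \<and> V \<noteq> {} \<and>
     (\<forall>a\<in>V. \<forall>b\<in>V. \<exists>p\<in>paths V E. hd p = a \<and> last p = b)"


section \<open>Graded algebras over a field\<close>

text \<open>An algebra over the field \<open>'k\<close> is a (not necessarily commutative) ring with a scalar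
  multiplication; \<open>component A n\<close> is its homogeneous part of degree \<open>n\<close>.\<close>

record ('k, 'b) graded_algebra = "('k, 'b) module" +
  component :: "nat \<Rightarrow> 'b set"

definition graded_alg_iso ::
  "('k, 'b) graded_algebra \<Rightarrow> ('k, 'c) graded_algebra \<Rightarrow> ('b \<Rightarrow> 'c) set" where
  "graded_alg_iso A B = {h \<in> ring_iso A B.
     (\<forall>c. \<forall>x\<in>carrier A. h (c \<odot>\<^bsub>A\<^esub> x) = c \<odot>\<^bsub>B\<^esub> h x) \<and>
     (\<forall>n. h ` component A n = component B n)}"

text \<open>The quotient by a two-sided homogeneous ideal: \<^const>\<open>FactRing\<close> with the induced scalar
  multiplication \<open>c (I + x) = I + c x\<close> and the induced grading.\<close>

definition quot_algebra ::
  "('k, 'b) graded_algebra \<Rightarrow> 'b set \<Rightarrow> ('k, 'b set) graded_algebra" where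
  "quot_algebra A I =
    \<lparr>carrier = carrier (A Quot I), monoid.mult = monoid.mult (A Quot I), one = one (A Quot I),
     ring.zero = ring.zero (A Quot I), ring.add = ring.add (A Quot I),
     module.smult = (\<lambda>c X. \<Union>x\<in>X. I +>\<^bsub>A\<^esub> (c \<odot>\<^bsub>A\<^esub> x)),
     component = (\<lambda>n. (\<lambda>x. I +>\<^bsub>A\<^esub> x) ` component A n)\<rparr>"


section \<open>The path algebra of the double quiver\<close>

text \<open>Elements are the finitely supported functions on paths; \<open>Poly_Mapping.single p 1\<close> is the
  basis element \<open>p\<close>.\<close>

definition path_mult :: "('v list \<Rightarrow>\<^sub>0 'k::field) \<Rightarrow> ('v list \<Rightarrow>\<^sub>0 'k) \<Rightarrow> ('v list \<Rightarrow>\<^sub>0 'k)" where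
  "path_mult f g = (\<Sum>p\<in>Poly_Mapping.keys f. \<Sum>q\<in>Poly_Mapping.keys g.
     if last p = hd q
     then Poly_Mapping.single (p @ tl q) (Poly_Mapping.lookup f p * Poly_Mapping.lookup g q)
     else 0)"

definition path_algebra ::
  "'v set \<Rightarrow> 'v set set \<Rightarrow> ('k::field, 'v list \<Rightarrow>\<^sub>0 'k) graded_algebra" where
  "path_algebra V E =
    \<lparr>carrier = {f. Poly_Mapping.keys f \<subseteq> paths V E},
     monoid.mult = path_mult,
     one = (\<Sum>a\<in>V. Poly_Mapping.single [a] 1),
     ring.zero = 0,
     ring.add = (+),
     module.smult = (\<lambda>c. Poly_Mapping.map ((*) c)),
     component = (\<lambda>n. {f. Poly_Mapping.keys f \<subseteq> {p \<in> paths V E. path_length p = n}})\<rparr>"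


section \<open>Skew-zigzag algebras\<close>

text \<open>The coefficient \<open>v\<^sup>a\<^sub>b\<^sub>,\<^sub>c\<close> is \<open>v a b c\<close>. A collection has entries only for
  \<open>{a, b}, {a, c} \<in> E\<close>; a function representing it takes the value \<^const>\<open>undefined\<close>
  elsewhere.\<close>

definition SZC :: "'v set set \<Rightarrow> ('v \<Rightarrow> 'v \<Rightarrow> 'v \<Rightarrow> 'k::field) set" where
  "SZC E = {v.
     (\<forall>a b. {a, b} \<in> E \<longrightarrow> v a b b = 1) \<and>
     (\<forall>a b c. {a, b} \<in> E \<and> {a, c} \<in> E \<longrightarrow> v a b c * v a c b = 1) \<and>
     (\<forall>a b c d. {a, b} \<in> E \<and> {a, c} \<in> E \<and> {a, d} \<in> E \<longrightarrow>
        v a b c * v a c d * v a d b = 1) \<and>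
     (\<forall>a b c. \<not> ({a, b} \<in> E \<and> {a, c} \<in> E) \<longrightarrow> v a b c = undefined)}"

definition zigzag_relations ::
  "'v set \<Rightarrow> 'v set set \<Rightarrow> ('v \<Rightarrow> 'v \<Rightarrow> 'v \<Rightarrow> 'k::field) \<Rightarrow> ('v list \<Rightarrow>\<^sub>0 'k) set" where
  "zigzag_relations V E v =
     {Poly_Mapping.single [a1, a2, a3] 1 | a1 a2 a3. [a1, a2, a3] \<in> paths V E \<and> a1 \<noteq> a3} \<union>
     {Poly_Mapping.single [a1, a2, a1] 1 - Poly_Mapping.single [a1, a3, a1] (v a1 a2 a3)
       | a1 a2 a3. {a1, a2} \<in> E \<and> {a1, a3} \<in> E}"

text \<open>The polynomial ring \<open>\<Bbbk>[X]\<close>, graded so that \<open>X\<close> has degree \<open>2\<close>.\<close>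

definition poly_algebra :: "('k::field, 'k poly) graded_algebra" where
  "poly_algebra =
    \<lparr>carrier = UNIV, monoid.mult = (*), one = 1, ring.zero = 0, ring.add = (+),
     module.smult = Polynomial.smult,
     component = (\<lambda>n. {p. \<forall>i. coeff p i \<noteq> 0 \<longrightarrow> 2 * i = n})\<rparr>"

text \<open>The algebra of a one-vertex graph is a quotient of a polynomial ring, all others are quotients
  of path algebras. As these have elements of different types, algebras of both kinds are
  collected in a sum type.\<close>

type_synonym ('v, 'k) zigzag =
  "('k, ('v list \<Rightarrow>\<^sub>0 'k) set) graded_algebra + ('k, 'k poly set) graded_algebra"

definition skew_zigzag ::
  "'v set \<Rightarrow> 'v set set \<Rightarrow> ('v \<Rightarrow> 'v \<Rightarrow> 'v \<Rightarrow> 'k::field) \<Rightarrow> ('v, 'k) zigzag" where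
  "skew_zigzag V E v =
    (if card V = 1 then
       Inr (quot_algebra poly_algebra (Idl\<^bsub>poly_algebra\<^esub> {[:0, 1:] ^ 2}))
     else if card V = 2 then
       Inl (quot_algebra (path_algebra V E) (Idl\<^bsub>path_algebra V E\<^esub>
         {Poly_Mapping.single p 1 | p. p \<in> paths V E \<and> path_length p > 2}))
     else
       Inl (quot_algebra (path_algebra V E) (Idl\<^bsub>path_algebra V E\<^esub> (zigzag_relations V E v))))"

fun zigzag_isomorphic :: "('v, 'k) zigzag \<Rightarrow> ('v, 'k) zigzag \<Rightarrow> bool" where
  "zigzag_isomorphic (Inl A) (Inl B) \<longleftrightarrow> graded_alg_iso A B \<noteq> {}"
| "zigzag_isomorphic (Inl A) (Inr B) \<longleftrightarrow> graded_alg_iso A B \<noteq> {}"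
| "zigzag_isomorphic (Inr A) (Inl B) \<longleftrightarrow> graded_alg_iso A B \<noteq> {}"
| "zigzag_isomorphic (Inr A) (Inr B) \<longleftrightarrow> graded_alg_iso A B \<noteq> {}"

definition Sigma_algs :: "'v set \<Rightarrow> 'v set set \<Rightarrow> ('v, 'k::field) zigzag set" where
  "Sigma_algs V E = skew_zigzag V E ` SZC E"

definition iso_classes :: "('v, 'k) zigzag set \<Rightarrow> ('v, 'k) zigzag set set" where
  "iso_classes S = S // {(A, B). A \<in> S \<and> B \<in> S \<and> zigzag_isomorphic A B}"


section \<open>Cycles and cohomology\<close>

text \<open>The quotient of \<open>\<int>E'\<close> by the subgroup generated by all \<open>(a | b) + (b | a)\<close>.\<close>

definition edge_group :: "'v set set \<Rightarrow> (('v \<times> 'v) \<Rightarrow>\<^sub>0 int) set monoid" where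
  "edge_group E = free_Abelian_group (arcs E) Mod
     generate (free_Abelian_group (arcs E))
       {frag_of (a, b) + frag_of (b, a) | a b. {a, b} \<in> E}"

text \<open>The linear extension of \<open>(a | b) \<mapsto> a - b\<close> is constant on the cosets that are the elements
  of \<^const>\<open>edge_group\<close>.\<close>

definition boundary :: "(('v \<times> 'v) \<Rightarrow>\<^sub>0 int) set \<Rightarrow> ('v \<Rightarrow>\<^sub>0 int)" where
  "boundary X = the_elem (frag_extend (\<lambda>(a, b). frag_of a - frag_of b) ` X)"

definition cycle_space :: "'v set \<Rightarrow> 'v set set \<Rightarrow> (('v \<times> 'v) \<Rightarrow>\<^sub>0 int) set monoid" where
  "cycle_space V E =
     (edge_group E)\<lparr>carrier := kernel (edge_group E) (free_Abelian_group V) boundary\<rparr>"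

definition mult_group_of_field :: "'k::field monoid" where
  "mult_group_of_field = \<lparr>carrier = {x. x \<noteq> 0}, monoid.mult = (*), one = 1\<rparr>"

text \<open>Homomorphisms are functions on the carrier, hence \<^const>\<open>extensional\<close>.\<close>

definition H1 ::
  "'v set \<Rightarrow> 'v set set \<Rightarrow> ((('v \<times> 'v) \<Rightarrow>\<^sub>0 int) set \<Rightarrow> 'k::field) set" where
  "H1 V E = hom (cycle_space V E) mult_group_of_field \<inter> extensional (carrier (cycle_space V E))"


section \<open>The action of the automorphism group\<close>

definition graph_aut :: "'v set \<Rightarrow> 'v set set \<Rightarrow> ('v \<Rightarrow> 'v) monoid" where
  "graph_aut V E =
    \<lparr>carrier = {\<sigma>. \<sigma> permutes V \<and> (\<forall>a\<in>V. \<forall>b\<in>V. {a, b} \<in> E \<longleftrightarrow> {\<sigma> a, \<sigma> b} \<in> E)},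
     monoid.mult = (\<circ>), one = id\<rparr>"

text \<open>An automorphism permutes the generators \<open>(a | b) + (b | a)\<close>, so its linear extension to
  \<open>\<int>E'\<close> maps cosets onto cosets.\<close>

definition cycle_act ::
  "('v \<Rightarrow> 'v) \<Rightarrow> (('v \<times> 'v) \<Rightarrow>\<^sub>0 int) set \<Rightarrow> (('v \<times> 'v) \<Rightarrow>\<^sub>0 int) set" where
  "cycle_act \<sigma> X = frag_extend (\<lambda>(a, b). frag_of (\<sigma> a, \<sigma> b)) ` X"

definition H1_act ::
  "'v set \<Rightarrow> 'v set set \<Rightarrow> ('v \<Rightarrow> 'v) \<Rightarrow> ((('v \<times> 'v) \<Rightarrow>\<^sub>0 int) set \<Rightarrow> 'k::field)
     \<Rightarrow> ((('v \<times> 'v) \<Rightarrow>\<^sub>0 int) set \<Rightarrow> 'k)" where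
  "H1_act V E \<sigma> f = restrict (\<lambda>C. f (cycle_act (inv_into UNIV \<sigma>) C)) (carrier (cycle_space V E))"

end

theory Submission
  imports Defs
begin

text \<open>
  The cocycle conditions on the entries \<open>v a b c\<close> at a vertex \<open>a\<close> say that they are ratios
  \<open>x a b / x a c\<close> of nonzero weights on the arcs, determined up to one scalar for each
  vertex \<open>a\<close>. The quotients \<open>u (a, b) = x a b / x b a\<close> satisfy \<open>u (a, b) u (b, a) = 1\<close>, so \<open>u\<close> is
  a homomorphism from the group generated by the arcs modulo \<open>(a | b) + (b | a)\<close>. Rescaling the
  weights at \<open>a\<close> by \<open>\<mu> a\<close> multiplies \<open>u (a, b)\<close> by \<open>\<mu> a / \<mu> b\<close>, which is trivial on cycles. Thus
  \<open>v\<close> has a well-defined class in \<open>H\<^sup>1\<close>, and every class arises in this way because homomorphisms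
  on cycles extend to all chains.

  A graded isomorphism from \<open>A\<^sub>v\<close> to \<open>A\<^sub>w\<close> permutes the primitive idempotents of degree \<open>0\<close>, which
  gives a permutation \<open>\<sigma>\<close> of the vertices. In degree \<open>1\<close> it then has to send an arc \<open>(a | b)\<close> to
  \<open>c a b (\<sigma> a | \<sigma> b)\<close> with \<open>c a b \<noteq> 0\<close>, so \<open>\<sigma>\<close> is an automorphism of the graph. With
  \<open>d a b = c a b c b a\<close>, the relations in degree \<open>2\<close> become
  \<open>w (\<sigma> a) (\<sigma> b) (\<sigma> c) d a b = v a b c d a c\<close>. Conversely, if a symmetric \<open>d\<close> satisfies this,
  then taking for \<open>c\<close> a square root of \<open>d\<close> defines an isomorphism. Hence only the existence of a
  pair \<open>(\<sigma>, d)\<close> matters (\<open>iso_if_szc_equiv\<close>, \<open>szc_equiv_if_iso\<close>). Rewritten in the weights, the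
  condition on \<open>d\<close> says exactly that \<open>u\<^sub>w \<circ> \<sigma>\<close> and \<open>u\<^sub>v\<close> differ by some \<open>\<mu> a / \<mu> b\<close>, which on a
  connected graph means that they agree on cycles (\<open>szc_class_eq_iff_twist\<close>). So \<open>A\<^sub>v\<close> and \<open>A\<^sub>w\<close>
  are isomorphic if and only if the classes of \<open>v\<close> and \<open>w\<close> lie in the same orbit, and the two sets of
  the theorem are images of the set of all coefficients under maps with the same fibres.

  The comparison in degree \<open>2\<close> needs that the loops \<open>(a | b | a)\<close> do not vanish in the quotient.
  This is seen without computing a basis: the linear form taking each \<open>(a | b | a)\<close> to its weight
  \<open>x a b\<close> kills the relations, and elements of degree at least \<open>2\<close> killed by these forms form
  an ideal (\<open>zigzag_ideal_vanishing\<close>).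

  With at most two vertices the algebras are defined differently, but there is then only one
  collection of coefficients, so that both sets have one element.
\<close>

section \<open>Cohomology classes as multiplicative functions on arcs\<close>

lemma arcs_iff: "(a, b) \<in> arcs E \<longleftrightarrow> {a, b} \<in> E"
  by (simp add: arcs_def)

lemma edge_endpoints:
  assumes "simple_graph V E" "{a, b} \<in> E"
  shows "a \<in> V" "b \<in> V" "a \<noteq> b"
  using assms by (auto simp: simple_graph_def)

definition arc_prod :: "('a \<Rightarrow> 'k::field) \<Rightarrow> ('a \<Rightarrow>\<^sub>0 int) \<Rightarrow> 'k" where
  "arc_prod u c = (\<Prod>x\<in>Poly_Mapping.keys c. u x powi Poly_Mapping.lookup c x)"

lemma arc_prod_superset:
  assumes "finite A" "Poly_Mapping.keys c \<subseteq> A"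
  shows "arc_prod u c = (\<Prod>x\<in>A. u x powi Poly_Mapping.lookup c x)"
  unfolding arc_prod_def
  by (rule prod.mono_neutral_left) (use assms in \<open>auto simp: in_keys_iff\<close>)

lemma arc_prod_0 [simp]: "arc_prod u 0 = 1"
  by (simp add: arc_prod_def)

lemma arc_prod_frag_of [simp]: "arc_prod u (frag_of x) = u x"
  by (simp add: arc_prod_def)

lemma arc_prod_diff:
  assumes "\<And>x. u x \<noteq> 0"
  shows "arc_prod u (c - d) = arc_prod u c / arc_prod u d"
proof -
  let ?A = "Poly_Mapping.keys c \<union> Poly_Mapping.keys d"
  have "arc_prod u (c - d) = (\<Prod>x\<in>?A. u x powi Poly_Mapping.lookup (c - d) x)"
    by (rule arc_prod_superset) (auto dest: subsetD[OF keys_diff])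
  also have "\<dots> = (\<Prod>x\<in>?A. u x powi Poly_Mapping.lookup c x / u x powi Poly_Mapping.lookup d x)"
    by (simp add: lookup_minus power_int_diff assms)
  also have "\<dots> = arc_prod u c / arc_prod u d"
    by (simp add: prod_dividef arc_prod_superset[of ?A c] arc_prod_superset[of ?A d])
  finally show ?thesis .
qed

lemma arc_prod_nonzero: "(\<And>x. u x \<noteq> 0) \<Longrightarrow> arc_prod u c \<noteq> 0"
  by (simp add: arc_prod_def)

lemma arc_prod_minus: "(\<And>x. u x \<noteq> 0) \<Longrightarrow> arc_prod u (- c) = inverse (arc_prod u c)"
  using arc_prod_diff[of u 0 c] by (simp add: divide_inverse)

lemma arc_prod_add:
  assumes "\<And>x. u x \<noteq> 0"
  shows "arc_prod u (c + d) = arc_prod u c * arc_prod u d"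
  using arc_prod_diff[of u c "- d"] arc_prod_minus[of u d] assms by (simp add: divide_inverse)

lemma arc_prod_divide: "arc_prod (\<lambda>x. u x / w x) c = arc_prod u c / arc_prod w c"
  by (simp add: arc_prod_def power_int_divide_distrib prod_dividef)

abbreviation bd :: "(('v \<times> 'v) \<Rightarrow>\<^sub>0 int) \<Rightarrow> ('v \<Rightarrow>\<^sub>0 int)" where
  "bd \<equiv> frag_extend (\<lambda>(a, b). frag_of a - frag_of b)"

text \<open>Representatives for the cycle space, whose elements are cosets of chains.\<close>

definition cycles :: "'v set set \<Rightarrow> (('v \<times> 'v) \<Rightarrow>\<^sub>0 int) set" where
  "cycles E = {c. Poly_Mapping.keys c \<subseteq> arcs E \<and> bd c = 0}"

definition reversals :: "'v set set \<Rightarrow> (('v \<times> 'v) \<Rightarrow>\<^sub>0 int) set" where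
  "reversals E = generate (free_Abelian_group (arcs E))
       {frag_of (a, b) + frag_of (b, a) | a b. {a, b} \<in> E}"

abbreviation arc_class :: "'v set set \<Rightarrow> (('v \<times> 'v) \<Rightarrow>\<^sub>0 int) \<Rightarrow> (('v \<times> 'v) \<Rightarrow>\<^sub>0 int) set" where
  "arc_class E c \<equiv> reversals E #>\<^bsub>free_Abelian_group (arcs E)\<^esub> c"

lemma reversal_generators_subset:
  "{frag_of (a, b) + frag_of (b, a) | a b. {a, b} \<in> E} \<subseteq> carrier (free_Abelian_group (arcs E))"
  by (auto simp: arcs_iff insert_commute dest!: subsetD[OF keys_add])

lemma reversals_normal: "reversals E \<lhd> free_Abelian_group (arcs E)"
  unfolding reversals_def
  by (intro comm_group.subgroup_imp_normal abelian_free_Abelian_group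
      group.generate_is_subgroup group_free_Abelian_group reversal_generators_subset)

lemma reversals_keys: "n \<in> reversals E \<Longrightarrow> Poly_Mapping.keys n \<subseteq> arcs E"
  using subsetD[OF subgroup.subset[OF normal_imp_subgroup[OF reversals_normal[of E]]]] by simp

lemma zero_in_reversals: "0 \<in> reversals E"
  using subgroup.one_closed[OF normal_imp_subgroup[OF reversals_normal[of E]]] by simp

text \<open>This serves to verify that maps on chains descend to the quotient.\<close>

lemma reversals_induct [consumes 1, case_names zero gen minus add]:
  assumes "n \<in> reversals E" "P 0"
    and "\<And>a b. {a, b} \<in> E \<Longrightarrow> P (frag_of (a, b) + frag_of (b, a))"
    and "\<And>x. P x \<Longrightarrow> P (- x)" "\<And>x y. P x \<Longrightarrow> P y \<Longrightarrow> P (x + y)"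
  shows "P n"
  using assms(1) unfolding reversals_def
proof (induction rule: generate.induct)
  case one
  show ?case using assms(2) by simp
next
  case (incl h)
  then obtain a b where "h = frag_of (a, b) + frag_of (b, a)" "{a, b} \<in> E" by auto
  then show ?case using assms(3)[of a b] by simp
next
  case (inv h)
  then obtain a b where h: "h = frag_of (a, b) + frag_of (b, a)" "{a, b} \<in> E" by auto
  have "Poly_Mapping.keys h \<subseteq> arcs E"
    using subsetD[OF reversal_generators_subset inv] by simp
  then have "inv\<^bsub>free_Abelian_group (arcs E)\<^esub> h = - h" by simp
  moreover have "P (- h)" using assms(4)[OF assms(3)[OF h(2)]] h(1) by simp
  ultimately show ?case by simp
next
  case (eng x y)
  then show ?case using assms(5)[of x y] by simp
qed

lemma arc_class_eq: "arc_class E c = {n + c | n. n \<in> reversals E}"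
  by (auto simp: r_coset_def)

lemma self_in_arc_class: "c \<in> arc_class E c"
  using zero_in_reversals[of E] by (auto simp: arc_class_eq intro!: exI[of _ 0])

lemma bd_reversals: "n \<in> reversals E \<Longrightarrow> bd n = 0"
  by (induction rule: reversals_induct) (auto simp: frag_extend_add frag_extend_minus)

lemma arc_prod_reversals:
  assumes "\<And>x. u x \<noteq> 0" "\<And>a b. {a, b} \<in> E \<Longrightarrow> u (a, b) * u (b, a) = 1" "n \<in> reversals E"
  shows "arc_prod u n = 1"
  using assms(3)
  by (induction rule: reversals_induct) (auto simp: arc_prod_add arc_prod_minus assms(1,2))

lemma boundary_arc_class: "boundary (arc_class E c) = bd c"
proof -
  have "bd ` arc_class E c = {bd c}"
    using self_in_arc_class[of c E] by (auto simp: arc_class_eq frag_extend_add bd_reversals)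
  then show ?thesis by (simp add: boundary_def)
qed

lemma carrier_cycle_space: "carrier (cycle_space V E) = arc_class E ` cycles E"
  by (auto simp: cycle_space_def kernel_def edge_group_def FactGroup_def RCOSETS_def cycles_def
      boundary_arc_class simp flip: reversals_def)

lemma mult_cycle_space:
  assumes "c \<in> cycles E" "d \<in> cycles E"
  shows "arc_class E c \<otimes>\<^bsub>cycle_space V E\<^esub> arc_class E d = arc_class E (c + d)"
  using normal.rcos_sum[OF reversals_normal[of E], of c d] assms
  by (simp add: cycle_space_def edge_group_def FactGroup_def cycles_def flip: reversals_def)

lemma arc_class_reversal: "n \<in> reversals E \<Longrightarrow> arc_class E n = arc_class E 0"
  using group.coset_join2[OF group_free_Abelian_group _ normal_imp_subgroup[OF reversals_normal[of E]]]
    reversals_keys[of n E] zero_in_reversals[of E]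
  by (metis carrier_free_Abelian_group_iff reversals_keys)

lemma zero_cycle: "0 \<in> cycles E"
  by (simp add: cycles_def)

lemma add_cycle: "c \<in> cycles E \<Longrightarrow> d \<in> cycles E \<Longrightarrow> c + d \<in> cycles E"
  by (auto simp: cycles_def frag_extend_add dest!: subsetD[OF keys_add])

lemma diff_cycle: "c \<in> cycles E \<Longrightarrow> d \<in> cycles E \<Longrightarrow> c - d \<in> cycles E"
  by (auto simp: cycles_def frag_extend_diff dest!: subsetD[OF keys_diff])

text \<open>A multiplicative function that is \<open>1\<close> on all \<open>(a | b) + (b | a)\<close> is constant on cosets, so
  any representative can be evaluated.\<close>

definition class_of_arc_fun ::
  "'v set \<Rightarrow> 'v set set \<Rightarrow> (('v \<times> 'v) \<Rightarrow> 'k::field) \<Rightarrow> (('v \<times> 'v) \<Rightarrow>\<^sub>0 int) set \<Rightarrow> 'k" where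
  "class_of_arc_fun V E u =
    restrict (\<lambda>X. arc_prod u (SOME c. c \<in> X)) (carrier (cycle_space V E))"

text \<open>Being nonzero is required for all pairs, not only for arcs, so that
  \<^const>\<open>arc_prod\<close> is multiplicative on all chains.\<close>

definition antisymmetric_arc_fun :: "'v set set \<Rightarrow> (('v \<times> 'v) \<Rightarrow> 'k::field) \<Rightarrow> bool" where
  "antisymmetric_arc_fun E u \<longleftrightarrow>
    (\<forall>x. u x \<noteq> 0) \<and> (\<forall>a b. {a, b} \<in> E \<longrightarrow> u (a, b) * u (b, a) = 1)"

lemma antisymmetric_arc_funD:
  assumes "antisymmetric_arc_fun E u"
  shows "u x \<noteq> 0" "{a, b} \<in> E \<Longrightarrow> u (a, b) * u (b, a) = 1"
  using assms unfolding antisymmetric_arc_fun_def by blast+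

lemma class_of_arc_fun_eq:
  assumes "antisymmetric_arc_fun E u" "c \<in> cycles E"
  shows "class_of_arc_fun V E u (arc_class E c) = arc_prod u c"
proof -
  have "(SOME d. d \<in> arc_class E c) \<in> arc_class E c"
    using self_in_arc_class by (rule someI)
  then obtain n where "n \<in> reversals E" "(SOME d. d \<in> arc_class E c) = n + c"
    by (auto simp: arc_class_eq)
  then show ?thesis
    using assms(2) arc_prod_reversals[of u E n] antisymmetric_arc_funD[OF assms(1)]
    by (simp add: class_of_arc_fun_def carrier_cycle_space arc_prod_add)
qed

lemma class_of_arc_fun_H1:
  assumes "antisymmetric_arc_fun E u"
  shows "class_of_arc_fun V E u \<in> H1 V E"
proof -
  have "class_of_arc_fun V E u \<in> hom (cycle_space V E) mult_group_of_field"
  proof (rule homI)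
    show "class_of_arc_fun V E u X \<in> carrier mult_group_of_field"
      if "X \<in> carrier (cycle_space V E)" for X
      using that assms
      by (auto simp: carrier_cycle_space class_of_arc_fun_eq mult_group_of_field_def
          antisymmetric_arc_funD[OF assms] arc_prod_nonzero)
    show "class_of_arc_fun V E u (X \<otimes>\<^bsub>cycle_space V E\<^esub> Y) =
        class_of_arc_fun V E u X \<otimes>\<^bsub>mult_group_of_field\<^esub> class_of_arc_fun V E u Y"
      if "X \<in> carrier (cycle_space V E)" "Y \<in> carrier (cycle_space V E)" for X Y
      using that assms
      by (auto simp: carrier_cycle_space class_of_arc_fun_eq mult_cycle_space add_cycle
          mult_group_of_field_def antisymmetric_arc_funD[OF assms] arc_prod_add)
  qed
  then show ?thesis by (simp add: H1_def class_of_arc_fun_def)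
qed

lemma path_chain:
  assumes "p \<in> paths V E"
  shows "\<exists>T. Poly_Mapping.keys T \<subseteq> arcs E \<and> bd T = frag_of (hd p) - frag_of (last p)"
proof -
  have "successively (\<lambda>a b. (a, b) \<in> arcs E) p" "p \<noteq> []"
    using assms by (auto simp: paths_def)
  then show ?thesis
  proof (induction p rule: induct_list012)
    case (2 a)
    then show ?case by (auto intro!: exI[of _ 0])
  next
    case (3 a b p)
    then obtain T where "Poly_Mapping.keys T \<subseteq> arcs E"
      "bd T = frag_of b - frag_of (last (b # p))" "(a, b) \<in> arcs E" by auto
    then show ?case
      by (intro exI[of _ "frag_of (a, b) + T"])
        (auto simp: frag_extend_add dest!: subsetD[OF keys_add])
  qed simp
qed

text \<open>Connectedness enters through the choice of a path \<open>T a\<close> from a base point \<open>r\<close> to each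
  vertex \<open>a\<close>.\<close>

lemma path_system:
  assumes "connected_graph V E"
  obtains r T where "\<forall>a\<in>V. Poly_Mapping.keys (T a) \<subseteq> arcs E \<and> bd (T a) = frag_of r - frag_of a"
proof -
  obtain r where "r \<in> V" using assms by (auto simp: connected_graph_def)
  then have "\<forall>a\<in>V. \<exists>T. Poly_Mapping.keys T \<subseteq> arcs E \<and> bd T = frag_of r - frag_of a"
    using assms path_chain[of _ V E] by (metis connected_graph_def)
  then show thesis using that by metis
qed

lemma fundamental_cycle:
  assumes "\<forall>a\<in>V. Poly_Mapping.keys (T a) \<subseteq> arcs E \<and> bd (T a) = frag_of r - frag_of a"
    and "a \<in> V" "b \<in> V" "(a, b) \<in> arcs E"
  shows "T a + frag_of (a, b) - T b \<in> cycles E"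
  using assms
  by (auto simp: cycles_def frag_extend_add frag_extend_diff dest!: subsetD[OF keys_add] subsetD[OF keys_diff])

text \<open>The value on the path \<open>T a\<close> from the base point is, up to inversion, the function \<open>\<mu>\<close>:
  the fundamental cycle of an arc \<open>(a | b)\<close> compares \<open>T a\<close>, \<open>T b\<close> and the arc. Conversely, if
  \<open>g (a, b) = \<mu> a / \<mu> b\<close>, then the value of \<open>g\<close> on a chain is the value of \<open>\<mu>\<close> on
  its boundary.\<close>

lemma trivial_on_cycles_iff_coboundary:
  assumes G: "connected_graph V E" and nz: "\<And>x. g x \<noteq> (0 :: 'k::field)"
  shows "(\<forall>c\<in>cycles E. arc_prod g c = 1) \<longleftrightarrow>
    (\<exists>\<mu>. (\<forall>a. \<mu> a \<noteq> 0) \<and> (\<forall>a b. {a, b} \<in> E \<longrightarrow> g (a, b) = \<mu> a / \<mu> b))"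
proof
  assume triv: "\<forall>c\<in>cycles E. arc_prod g c = 1"
  obtain r T where T: "\<forall>a\<in>V. Poly_Mapping.keys (T a) \<subseteq> arcs E \<and> bd (T a) = frag_of r - frag_of a"
    using path_system[OF G] by metis
  have "g (a, b) = inverse (arc_prod g (T a)) / inverse (arc_prod g (T b))"
    if "{a, b} \<in> E" for a b
  proof -
    have "a \<in> V" "b \<in> V"
      using that G edge_endpoints[of V E a b] by (auto simp: connected_graph_def)
    then have "arc_prod g (T a + frag_of (a, b) - T b) = 1"
      using triv fundamental_cycle[OF T, of a b] that by (auto simp: arcs_iff)
    then show ?thesis
      by (simp add: arc_prod_add arc_prod_diff nz arc_prod_nonzero field_simps)
  qed
  then show "\<exists>\<mu>. (\<forall>a. \<mu> a \<noteq> 0) \<and> (\<forall>a b. {a, b} \<in> E \<longrightarrow> g (a, b) = \<mu> a / \<mu> b)"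
    by (intro exI[of _ "\<lambda>a. inverse (arc_prod g (T a))"]) (simp add: arc_prod_nonzero nz)
next
  assume "\<exists>\<mu>. (\<forall>a. \<mu> a \<noteq> 0) \<and> (\<forall>a b. {a, b} \<in> E \<longrightarrow> g (a, b) = \<mu> a / \<mu> b)"
  then obtain \<mu> where \<mu>: "\<And>a. \<mu> a \<noteq> 0" "\<And>a b. {a, b} \<in> E \<Longrightarrow> g (a, b) = \<mu> a / \<mu> b" by auto
  have "arc_prod g c = arc_prod \<mu> (bd c)" if "Poly_Mapping.keys c \<subseteq> arcs E" for c
    using that
    by (induction c rule: frag_induction)
      (auto simp: arcs_iff \<mu> arc_prod_diff frag_extend_diff nz)
  then show "\<forall>c\<in>cycles E. arc_prod g c = 1"
    by (simp add: cycles_def)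
qed

text \<open>\<open>\<int>V\<close> is free, so a homomorphism on cycles extends to all chains: with \<open>T a\<close> a path
  from the base point to \<open>a\<close>, an arc \<open>(a | b)\<close> is sent to the value at the fundamental
  cycle \<open>T a + (a | b) - T b\<close>.\<close>

lemma H1_from_arc_fun:
  fixes V :: "'v set" and E :: "'v set set"
  assumes G: "connected_graph V E" and f: "(f :: _ \<Rightarrow> 'k::field) \<in> H1 V E"
  obtains u where "antisymmetric_arc_fun E u" "class_of_arc_fun V E u = f"
proof -
  obtain r T where T: "\<forall>a\<in>V. Poly_Mapping.keys (T a) \<subseteq> arcs E \<and> bd (T a) = frag_of r - frag_of a"
    using path_system[OF G] by metis
  define F where "F c = f (arc_class E c)" for c :: "('v \<times> 'v) \<Rightarrow>\<^sub>0 int"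
  have F_nz: "F c \<noteq> 0" if "c \<in> cycles E" for c
    using f that unfolding F_def H1_def hom_def
    by (auto simp: mult_group_of_field_def carrier_cycle_space)
  have F_add: "F (c + d) = F c * F d" if "c \<in> cycles E" "d \<in> cycles E" for c d
    using f that hom_mult[of f "cycle_space V E" mult_group_of_field "arc_class E c" "arc_class E d"]
    by (simp add: F_def H1_def carrier_cycle_space mult_cycle_space mult_group_of_field_def)
  have F_0: "F 0 = 1"
    using F_add[of 0 0] F_nz[of 0] zero_cycle[of E] by simp
  have F_diff: "F (c - d) = F c / F d" if "c \<in> cycles E" "d \<in> cycles E" for c d
    using F_add[of "c - d" d] diff_cycle[OF that] that F_nz[of d] by (simp add: field_simps)
  define u where "u x = (if x \<in> arcs E
      then F (T (fst x) + frag_of x - T (snd x)) else 1)" for x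
  have fund: "T (fst x) + frag_of x - T (snd x) \<in> cycles E" if "x \<in> arcs E" for x
    using fundamental_cycle[OF T, of "fst x" "snd x"] that G edge_endpoints[of V E "fst x" "snd x"]
    by (cases x) (auto simp: arcs_iff connected_graph_def)
  have u_nz: "u x \<noteq> 0" for x
    using F_nz[OF fund[of x]] by (simp add: u_def)
  have "u (a, b) * u (b, a) = 1" if e: "{a, b} \<in> E" for a b
  proof -
    have arcs: "(a, b) \<in> arcs E" "(b, a) \<in> arcs E"
      using e by (auto simp: arcs_iff insert_commute)
    have "u (a, b) * u (b, a) =
        F ((T a + frag_of (a, b) - T b) + (T b + frag_of (b, a) - T a))"
      using F_add[OF fund[OF arcs(1)] fund[OF arcs(2)]] arcs by (simp add: u_def)
    also have "\<dots> = F (frag_of (a, b) + frag_of (b, a))"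
      by (simp add: algebra_simps)
    also have "\<dots> = F 0"
      unfolding F_def
      by (rule arg_cong[of _ _ f], rule arc_class_reversal)
        (use e in \<open>auto simp: reversals_def intro!: generate.incl\<close>)
    finally show ?thesis by (simp add: F_0)
  qed
  with u_nz have u: "antisymmetric_arc_fun E u" unfolding antisymmetric_arc_fun_def by blast
  \<comment> \<open>\<open>c + T (bd c)\<close> is the sum of the fundamental cycles of the arcs of \<open>c\<close>; on a cycle it is
    \<open>c\<close> itself.\<close>
  have ext: "arc_prod u c = F (c + frag_extend T (bd c)) \<and> c + frag_extend T (bd c) \<in> cycles E"
    if "Poly_Mapping.keys c \<subseteq> arcs E" for c
    using that
  proof (induction c rule: frag_induction)
    case zero
    then show ?case by (simp add: F_0 zero_cycle)
  next
    case (one x)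
    have "frag_of x + frag_extend T (bd (frag_of x)) = T (fst x) + frag_of x - T (snd x)"
      by (cases x) (simp add: frag_extend_diff)
    with one show ?case using fund[of x] by (simp only: arc_prod_frag_of u_def if_True)
  next
    case (diff c d)
    have "c - d + frag_extend T (bd (c - d)) =
        (c + frag_extend T (bd c)) - (d + frag_extend T (bd d))"
      by (simp add: frag_extend_diff)
    then show ?case
      using diff F_diff[of "c + frag_extend T (bd c)" "d + frag_extend T (bd d)"]
        diff_cycle[of "c + frag_extend T (bd c)" E "d + frag_extend T (bd d)"]
      by (simp only: arc_prod_diff[of u, OF u_nz])
  qed
  have "class_of_arc_fun V E u X = f X" for X
  proof (cases "X \<in> carrier (cycle_space V E)")
    case True
    then obtain c where c: "X = arc_class E c" "c \<in> cycles E"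
      by (auto simp: carrier_cycle_space)
    then have "arc_prod u c = F c" using ext[of c] by (simp add: cycles_def)
    then show ?thesis using c by (simp add: class_of_arc_fun_eq u F_def)
  next
    case False
    then show ?thesis
      using f by (simp add: class_of_arc_fun_def H1_def extensional_def)
  qed
  then show thesis using that u by blast
qed

lemma graph_aut_edge_iff:
  assumes "simple_graph V E" "\<sigma> \<in> carrier (graph_aut V E)"
  shows "{\<sigma> a, \<sigma> b} \<in> E \<longleftrightarrow> {a, b} \<in> E"
proof -
  have \<sigma>: "\<sigma> permutes V" "\<forall>a\<in>V. \<forall>b\<in>V. {a, b} \<in> E \<longleftrightarrow> {\<sigma> a, \<sigma> b} \<in> E"
    using assms by (auto simp: graph_aut_def)
  have "a \<in> V \<and> b \<in> V" if "{a, b} \<in> E" for a b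
    using edge_endpoints[OF assms(1) that] by simp
  then show ?thesis using \<sigma> by (metis permutes_in_image)
qed

lemma graph_aut_inv:
  assumes "simple_graph V E" "\<sigma> \<in> carrier (graph_aut V E)"
  shows "inv_into UNIV \<sigma> \<in> carrier (graph_aut V E)"
proof -
  have \<sigma>: "\<sigma> permutes V" using assms by (simp add: graph_aut_def)
  have "{inv_into UNIV \<sigma> a, inv_into UNIV \<sigma> b} \<in> E \<longleftrightarrow> {a, b} \<in> E" for a b
    using graph_aut_edge_iff[OF assms, of "inv_into UNIV \<sigma> a" "inv_into UNIV \<sigma> b"]
    by (simp add: permutes_inverses[OF \<sigma>])
  then show ?thesis by (simp add: graph_aut_def permutes_inv \<sigma>)
qed

lemma graph_aut_comp:
  assumes "simple_graph V E" "\<sigma> \<in> carrier (graph_aut V E)" "\<tau> \<in> carrier (graph_aut V E)"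
  shows "\<sigma> \<circ> \<tau> \<in> carrier (graph_aut V E)"
proof -
  have "\<sigma> \<circ> \<tau> permutes V"
    using assms by (simp add: graph_aut_def permutes_compose)
  moreover have "{\<sigma> (\<tau> a), \<sigma> (\<tau> b)} \<in> E \<longleftrightarrow> {a, b} \<in> E" for a b
    using graph_aut_edge_iff[OF assms(1,2)] graph_aut_edge_iff[OF assms(1,3)] by blast
  ultimately show ?thesis by (simp add: graph_aut_def)
qed

definition act_chain :: "('v \<Rightarrow> 'v) \<Rightarrow> (('v \<times> 'v) \<Rightarrow>\<^sub>0 int) \<Rightarrow> (('v \<times> 'v) \<Rightarrow>\<^sub>0 int)" where
  "act_chain \<sigma> = frag_extend (\<lambda>(a, b). frag_of (\<sigma> a, \<sigma> b))"

lemma act_chain_simps [simp]: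
  "act_chain \<sigma> 0 = 0" "act_chain \<sigma> (- c) = - act_chain \<sigma> c"
  "act_chain \<sigma> (c + d) = act_chain \<sigma> c + act_chain \<sigma> d"
  "act_chain \<sigma> (c - d) = act_chain \<sigma> c - act_chain \<sigma> d"
  "act_chain \<sigma> (frag_of (a, b)) = frag_of (\<sigma> a, \<sigma> b)"
  by (simp_all add: act_chain_def frag_extend_minus frag_extend_add frag_extend_diff)

lemma act_chain_inverse:
  assumes "\<And>x. \<sigma> (\<tau> x) = x"
  shows "act_chain \<sigma> (act_chain \<tau> c) = c"
  using subset_UNIV by (induction c rule: frag_induction) (auto simp: assms)

lemma bd_act_chain: "bd (act_chain \<sigma> c) = frag_extend (\<lambda>a. frag_of (\<sigma> a)) (bd c)"
  using subset_UNIV by (induction c rule: frag_induction) (auto simp: frag_extend_diff)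

lemma arc_prod_act_chain:
  assumes "\<And>x. u x \<noteq> 0"
  shows "arc_prod u (act_chain \<sigma> c) = arc_prod (\<lambda>(a, b). u (\<sigma> a, \<sigma> b)) c"
  using subset_UNIV
proof (induction c rule: frag_induction)
  case (diff c d)
  have "(case x of (a, b) \<Rightarrow> u (\<sigma> a, \<sigma> b)) \<noteq> 0" for x
    using assms by (cases x) simp
  then have "arc_prod (\<lambda>(a, b). u (\<sigma> a, \<sigma> b)) (c - d) =
      arc_prod (\<lambda>(a, b). u (\<sigma> a, \<sigma> b)) c / arc_prod (\<lambda>(a, b). u (\<sigma> a, \<sigma> b)) d"
    by (rule arc_prod_diff)
  with diff show ?case by (simp add: arc_prod_diff[OF assms])
qed auto

context
  fixes V :: "'v set" and E :: "'v set set" and \<sigma>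
  assumes G: "simple_graph V E" and \<sigma>: "\<sigma> \<in> carrier (graph_aut V E)"
begin

lemma keys_act_chain:
  assumes "Poly_Mapping.keys c \<subseteq> arcs E"
  shows "Poly_Mapping.keys (act_chain \<sigma> c) \<subseteq> arcs E"
  using assms
proof (induction c rule: frag_induction)
  case (one x)
  then show ?case using graph_aut_edge_iff[OF G \<sigma>] by (cases x) (simp add: arcs_iff)
next
  case (diff c d)
  then show ?case using keys_diff[of "act_chain \<sigma> c" "act_chain \<sigma> d"] by auto
qed simp

lemma act_chain_cycle: "c \<in> cycles E \<Longrightarrow> act_chain \<sigma> c \<in> cycles E"
  by (simp add: cycles_def bd_act_chain keys_act_chain)

lemma act_chain_reversals: "n \<in> reversals E \<Longrightarrow> act_chain \<sigma> n \<in> reversals E"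
proof (induction rule: reversals_induct)
  case (gen a b)
  then show ?case
    using graph_aut_edge_iff[OF G \<sigma>] by (auto simp: reversals_def intro!: generate.incl)
next
  case (minus x)
  then show ?case
    using subgroup.m_inv_closed[OF normal_imp_subgroup[OF reversals_normal[of E]] minus]
      reversals_keys[OF minus] by simp
next
  case (add x y)
  then show ?case
    using subgroup.m_closed[OF normal_imp_subgroup[OF reversals_normal[of E]] add] by simp
qed (simp add: zero_in_reversals)

end

lemma cycle_act_arc_class:
  assumes G: "simple_graph V E" and \<sigma>: "\<sigma> \<in> carrier (graph_aut V E)"
  shows "cycle_act \<sigma> (arc_class E c) = arc_class E (act_chain \<sigma> c)"
proof -
  have bij: "\<sigma> permutes V" using \<sigma> by (simp add: graph_aut_def)
  have "act_chain \<sigma> (act_chain (inv_into UNIV \<sigma>) n) = n" for n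
    by (rule act_chain_inverse) (simp add: permutes_inverses[OF bij])
  then have "act_chain \<sigma> ` reversals E = reversals E"
    using act_chain_reversals[OF G \<sigma>] act_chain_reversals[OF G graph_aut_inv[OF G \<sigma>]]
    by (metis image_subset_iff subsetI subset_antisym rev_image_eqI)
  moreover have img: "arc_class E d = (\<lambda>n. n + d) ` reversals E" for d
    by (auto simp: arc_class_eq)
  have "act_chain \<sigma> ` arc_class E c = (\<lambda>n. n + act_chain \<sigma> c) ` (act_chain \<sigma> ` reversals E)"
    by (simp add: img image_image)
  ultimately have "act_chain \<sigma> ` arc_class E c = arc_class E (act_chain \<sigma> c)"
    by (simp only: img)
  then show ?thesis by (simp add: cycle_act_def act_chain_def)
qed

text \<open>Replacing a cycle by its image under \<open>\<sigma>\<close> moves the automorphism from \<open>u\<close> to the arguments of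
  \<open>w\<close>; then \<open>trivial_on_cycles_iff_coboundary\<close> applies to the quotient of the two functions.\<close>

lemma class_eq_H1_act_iff:
  assumes conn: "connected_graph V E" and \<sigma>: "\<sigma> \<in> carrier (graph_aut V E)"
    and u: "antisymmetric_arc_fun E u" and w: "antisymmetric_arc_fun E (w :: _ \<Rightarrow> 'k::field)"
  shows "class_of_arc_fun V E w = H1_act V E \<sigma> (class_of_arc_fun V E u) \<longleftrightarrow>
    (\<exists>\<mu>. (\<forall>a. \<mu> a \<noteq> 0) \<and> (\<forall>a b. {a, b} \<in> E \<longrightarrow> w (\<sigma> a, \<sigma> b) / u (a, b) = \<mu> a / \<mu> b))"
proof -
  have G: "simple_graph V E" using conn by (simp add: connected_graph_def)
  have bij: "\<sigma> permutes V" using \<sigma> by (simp add: graph_aut_def)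
  let ?\<tau> = "inv_into UNIV \<sigma>"
  have \<tau>: "?\<tau> \<in> carrier (graph_aut V E)" by (rule graph_aut_inv[OF G \<sigma>])
  have nz: "u x \<noteq> 0" "w x \<noteq> 0" for x
    using antisymmetric_arc_funD(1)[OF u] antisymmetric_arc_funD(1)[OF w] by auto
  have nz': "(case x of (a, b) \<Rightarrow> w (\<sigma> a, \<sigma> b)) / u x \<noteq> 0" for x
    using nz by (cases x) simp
  have "class_of_arc_fun V E w = H1_act V E \<sigma> (class_of_arc_fun V E u) \<longleftrightarrow>
    (\<forall>X\<in>carrier (cycle_space V E). class_of_arc_fun V E w X = class_of_arc_fun V E u (cycle_act ?\<tau> X))"
    by (auto simp: H1_act_def fun_eq_iff class_of_arc_fun_def)
  also have "\<dots> \<longleftrightarrow> (\<forall>c\<in>cycles E. arc_prod w c = arc_prod u (act_chain ?\<tau> c))"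
    by (simp add: carrier_cycle_space class_of_arc_fun_eq u w cycle_act_arc_class[OF G \<tau>]
        act_chain_cycle[OF G \<tau>])
  also have "\<dots> \<longleftrightarrow> (\<forall>c\<in>cycles E. arc_prod w (act_chain \<sigma> c) = arc_prod u c)"
    using act_chain_cycle[OF G \<sigma>] act_chain_cycle[OF G \<tau>]
      act_chain_inverse[of \<sigma> ?\<tau>] act_chain_inverse[of ?\<tau> \<sigma>] permutes_inverses[OF bij]
    by metis
  also have "\<dots> \<longleftrightarrow> (\<forall>c\<in>cycles E. arc_prod (\<lambda>x. (case x of (a, b) \<Rightarrow> w (\<sigma> a, \<sigma> b)) / u x) c = 1)"
    by (simp add: arc_prod_act_chain nz arc_prod_divide arc_prod_nonzero)
  also have "\<dots> \<longleftrightarrow> (\<exists>\<mu>. (\<forall>a. \<mu> a \<noteq> 0) \<and>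
      (\<forall>a b. {a, b} \<in> E \<longrightarrow> w (\<sigma> a, \<sigma> b) / u (a, b) = \<mu> a / \<mu> b))"
    by (simp only: trivial_on_cycles_iff_coboundary[OF conn nz'] prod.case)
  finally show ?thesis .
qed

section \<open>Skew-zigzag coefficients and their cohomology classes\<close>

text \<open>The weights are normalised to be \<open>1\<close> at an arbitrarily chosen neighbour of each vertex.\<close>

definition neighbour :: "'v set set \<Rightarrow> 'v \<Rightarrow> 'v" where
  "neighbour E a = (SOME c. {a, c} \<in> E)"

definition szc_weight :: "'v set set \<Rightarrow> ('v \<Rightarrow> 'v \<Rightarrow> 'v \<Rightarrow> 'k::field) \<Rightarrow> 'v \<Rightarrow> 'v \<Rightarrow> 'k" where
  "szc_weight E v a b = v a b (neighbour E a)"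

definition szc_arc_fun ::
  "'v set set \<Rightarrow> ('v \<Rightarrow> 'v \<Rightarrow> 'v \<Rightarrow> 'k::field) \<Rightarrow> 'v \<times> 'v \<Rightarrow> 'k" where
  "szc_arc_fun E v = (\<lambda>(a, b). if {a, b} \<in> E then szc_weight E v a b / szc_weight E v b a else 1)"

abbreviation szc_class ::
  "'v set \<Rightarrow> 'v set set \<Rightarrow> ('v \<Rightarrow> 'v \<Rightarrow> 'v \<Rightarrow> 'k::field) \<Rightarrow> (('v \<times> 'v) \<Rightarrow>\<^sub>0 int) set \<Rightarrow> 'k" where
  "szc_class V E v \<equiv> class_of_arc_fun V E (szc_arc_fun E v)"

lemma neighbour_edge: "{a, b} \<in> E \<Longrightarrow> {a, neighbour E a} \<in> E"
  unfolding neighbour_def by (rule someI)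

lemma SZC_D:
  assumes "v \<in> SZC E"
  shows "{a, b} \<in> E \<Longrightarrow> v a b b = 1"
    and "{a, b} \<in> E \<Longrightarrow> {a, c} \<in> E \<Longrightarrow> v a b c * v a c b = 1"
    and "{a, b} \<in> E \<Longrightarrow> {a, c} \<in> E \<Longrightarrow> {a, d} \<in> E \<Longrightarrow> v a b c * v a c d * v a d b = 1"
    and "\<not> ({a, b} \<in> E \<and> {a, c} \<in> E) \<Longrightarrow> v a b c = undefined"
  using assms unfolding SZC_def by blast+

lemma szc_weight_nonzero:
  assumes "v \<in> SZC E" "{a, b} \<in> E"
  shows "szc_weight E v a b \<noteq> 0"
  using SZC_D(2)[OF assms(1,2) neighbour_edge[OF assms(2)]] by (auto simp: szc_weight_def)

lemma szc_eq_weight_ratio: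
  assumes "v \<in> SZC E" "{a, b} \<in> E" "{a, c} \<in> E"
  shows "v a b c = szc_weight E v a b / szc_weight E v a c"
proof -
  let ?n = "neighbour E a"
  have n: "{a, ?n} \<in> E" by (rule neighbour_edge[OF assms(2)])
  have "v a b c * v a c ?n * v a ?n b = 1" "v a b ?n * v a ?n b = 1" "v a c ?n \<noteq> 0"
    using SZC_D(3)[OF assms n] SZC_D(2)[OF assms(1,2) n] szc_weight_nonzero[OF assms(1,3)]
    by (auto simp: szc_weight_def)
  moreover from this have "v a ?n b \<noteq> 0" by auto
  ultimately have "v a b c * v a c ?n = v a b ?n" by (metis mult_right_cancel)
  with \<open>v a c ?n \<noteq> 0\<close> show ?thesis by (simp add: szc_weight_def field_simps)
qed

lemma szc_arc_fun_antisymmetric: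
  assumes "v \<in> SZC E"
  shows "antisymmetric_arc_fun E (szc_arc_fun E v)"
proof -
  have "szc_weight E v a b \<noteq> 0 \<and> szc_weight E v b a \<noteq> 0" if "{a, b} \<in> E" for a b
    using szc_weight_nonzero[OF assms, of a b] szc_weight_nonzero[OF assms, of b a] that
    by (simp add: insert_commute)
  then show ?thesis
    by (auto simp: antisymmetric_arc_fun_def szc_arc_fun_def insert_commute)
qed

lemma weight_ratios_in_SZC:
  assumes "\<And>a b. {a, b} \<in> E \<Longrightarrow> x a b \<noteq> 0"
  shows "(\<lambda>a b c. if {a, b} \<in> E \<and> {a, c} \<in> E then x a b / x a c else undefined) \<in> SZC E"
  using assms by (auto simp: SZC_def)

text \<open>The trace that an isomorphism leaves on the coefficients: if it sends \<open>(a | b)\<close> to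
  \<open>c a b (\<sigma> a | \<sigma> b)\<close>, then \<open>d a b = c a b c b a\<close> is its factor on the loop \<open>(a | b | a)\<close>.\<close>

definition szc_twist ::
  "'v set set \<Rightarrow> ('v \<Rightarrow> 'v) \<Rightarrow> ('v \<Rightarrow> 'v \<Rightarrow> 'v \<Rightarrow> 'k::field) \<Rightarrow> ('v \<Rightarrow> 'v \<Rightarrow> 'v \<Rightarrow> 'k) \<Rightarrow> bool" where
  "szc_twist E \<sigma> v w \<longleftrightarrow>
    (\<exists>d. (\<forall>a b. {a, b} \<in> E \<longrightarrow> d a b \<noteq> 0 \<and> d a b = d b a) \<and>
      (\<forall>a b c. {a, b} \<in> E \<longrightarrow> {a, c} \<in> E \<longrightarrow>
        w (\<sigma> a) (\<sigma> b) (\<sigma> c) * d a b = v a b c * d a c))"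

lemma szc_twistI:
  assumes "\<And>a b. {a, b} \<in> E \<Longrightarrow> d a b \<noteq> 0" "\<And>a b. {a, b} \<in> E \<Longrightarrow> d a b = d b a"
    "\<And>a b c. {a, b} \<in> E \<Longrightarrow> {a, c} \<in> E \<Longrightarrow>
      w (\<sigma> a) (\<sigma> b) (\<sigma> c) * d a b = v a b c * d a c"
  shows "szc_twist E \<sigma> v w"
  unfolding szc_twist_def using assms by blast

lemma szc_twistE:
  assumes "szc_twist E \<sigma> v w"
  obtains d where "\<And>a b. {a, b} \<in> E \<Longrightarrow> d a b \<noteq> 0" "\<And>a b. {a, b} \<in> E \<Longrightarrow> d a b = d b a"
    "\<And>a b c. {a, b} \<in> E \<Longrightarrow> {a, c} \<in> E \<Longrightarrow>
      w (\<sigma> a) (\<sigma> b) (\<sigma> c) * d a b = v a b c * d a c"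
  using assms unfolding szc_twist_def by blast

text \<open>With weights \<open>x\<close> of \<open>v\<close> and \<open>y\<close> of \<open>w\<close> at the \<open>\<sigma>\<close>-images, the equation for \<open>d\<close> says that
  \<open>\<mu> a = y a b d a b / x a b\<close> is independent of \<open>b\<close>. The symmetry of \<open>d\<close> is then the equation
  \<open>(y a b / y b a) / (x a b / x b a) = \<mu> a / \<mu> b\<close> for the classes.\<close>

lemma szc_class_eq_iff_twist:
  fixes v w :: "'v \<Rightarrow> 'v \<Rightarrow> 'v \<Rightarrow> 'k::field"
  assumes conn: "connected_graph V E" and \<sigma>: "\<sigma> \<in> carrier (graph_aut V E)"
    and v: "v \<in> SZC E" and w: "w \<in> SZC E"
  shows "szc_class V E w = H1_act V E \<sigma> (szc_class V E v) \<longleftrightarrow> szc_twist E \<sigma> v w"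
proof -
  let ?x = "szc_weight E v" and ?y = "\<lambda>a b. szc_weight E w (\<sigma> a) (\<sigma> b)"
  have G: "simple_graph V E" using conn by (simp add: connected_graph_def)
  have \<sigma>E: "{\<sigma> a, \<sigma> b} \<in> E \<longleftrightarrow> {a, b} \<in> E" for a b
    by (rule graph_aut_edge_iff[OF G \<sigma>])
  have sym: "{b, a} \<in> E" if "{a, b} \<in> E" for a b :: 'v
    using that by (simp add: insert_commute)
  have nz: "?x a b \<noteq> 0" "?y a b \<noteq> 0" if "{a, b} \<in> E" for a b
    using szc_weight_nonzero[OF v that] szc_weight_nonzero[OF w, of "\<sigma> a" "\<sigma> b"] that \<sigma>E[of a b]
    by auto
  have ratio: "w (\<sigma> a) (\<sigma> b) (\<sigma> c) = ?y a b / ?y a c" "v a b c = ?x a b / ?x a c"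
    if "{a, b} \<in> E" "{a, c} \<in> E" for a b c
    using szc_eq_weight_ratio[OF v that] szc_eq_weight_ratio[OF w, of "\<sigma> a" "\<sigma> b" "\<sigma> c"]
      that \<sigma>E[of a b] \<sigma>E[of a c] by auto
  have quot: "szc_arc_fun E w (\<sigma> a, \<sigma> b) / szc_arc_fun E v (a, b) =
      (?y a b / ?y b a) / (?x a b / ?x b a)" if "{a, b} \<in> E" for a b
    using that \<sigma>E[of a b] by (simp add: szc_arc_fun_def)
  have "(\<exists>\<mu>. (\<forall>a. \<mu> a \<noteq> 0) \<and> (\<forall>a b. {a, b} \<in> E \<longrightarrow>
      szc_arc_fun E w (\<sigma> a, \<sigma> b) / szc_arc_fun E v (a, b) = \<mu> a / \<mu> b)) \<longleftrightarrow> szc_twist E \<sigma> v w"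
    (is "?L \<longleftrightarrow> _")
  proof
    assume ?L
    then obtain \<mu> where \<mu>: "\<And>a. \<mu> a \<noteq> 0" "\<And>a b. {a, b} \<in> E \<Longrightarrow>
      szc_arc_fun E w (\<sigma> a, \<sigma> b) / szc_arc_fun E v (a, b) = \<mu> a / \<mu> b" by blast
    show "szc_twist E \<sigma> v w"
    proof (rule szc_twistI[where d = "\<lambda>a b. \<mu> a * ?x a b / ?y a b"])
      fix a b assume e: "{a, b} \<in> E"
      show "\<mu> a * ?x a b / ?y a b \<noteq> 0" using nz[OF e] \<mu>(1) by simp
      show "\<mu> a * ?x a b / ?y a b = \<mu> b * ?x b a / ?y b a"
        using \<mu>(2)[OF e] quot[OF e] nz[OF e] nz[OF sym[OF e]] \<mu>(1)[of a] \<mu>(1)[of b]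
        by (simp add: field_simps)
    next
      fix a b c assume e: "{a, b} \<in> E" "{a, c} \<in> E"
      show "w (\<sigma> a) (\<sigma> b) (\<sigma> c) * (\<mu> a * ?x a b / ?y a b) = v a b c * (\<mu> a * ?x a c / ?y a c)"
        using nz[OF e(1)] nz[OF e(2)] by (simp add: ratio[OF e])
    qed
  next
    assume "szc_twist E \<sigma> v w"
    then obtain d where d: "\<And>a b. {a, b} \<in> E \<Longrightarrow> d a b \<noteq> 0"
      "\<And>a b. {a, b} \<in> E \<Longrightarrow> d a b = d b a"
      "\<And>a b c. {a, b} \<in> E \<Longrightarrow> {a, c} \<in> E \<Longrightarrow>
        w (\<sigma> a) (\<sigma> b) (\<sigma> c) * d a b = v a b c * d a c"
      by (rule szc_twistE) blast
    define g where "g a b = ?y a b * d a b / ?x a b" for a b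
    define \<mu> where "\<mu> a = (if \<exists>b. {a, b} \<in> E then g a (neighbour E a) else 1)" for a
    have g: "g a b = g a c" if "{a, b} \<in> E" "{a, c} \<in> E" for a b c
      using d(3)[OF that] nz[OF that(1)] nz[OF that(2)] by (simp add: g_def ratio[OF that] field_simps)
    have \<mu>_eq: "\<mu> a = g a b" if "{a, b} \<in> E" for a b
      using g[OF that neighbour_edge[OF that]] that by (auto simp: \<mu>_def)
    have "g a b \<noteq> 0" if "{a, b} \<in> E" for a b
      using nz[OF that] d(1)[OF that] by (simp add: g_def)
    then have "\<mu> a \<noteq> 0" for a
      using neighbour_edge[of a _ E] by (auto simp: \<mu>_def)
    moreover have "szc_arc_fun E w (\<sigma> a, \<sigma> b) / szc_arc_fun E v (a, b) = \<mu> a / \<mu> b"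
      if "{a, b} \<in> E" for a b
      using nz[OF that] nz[OF sym[OF that]] d(1,2)[OF that]
      by (simp add: quot[OF that] \<mu>_eq[OF that] \<mu>_eq[OF sym[OF that]] g_def field_simps)
    ultimately show ?L by blast
  qed
  then show ?thesis
    using class_eq_H1_act_iff[OF conn \<sigma> szc_arc_fun_antisymmetric[OF v] szc_arc_fun_antisymmetric[OF w]]
    by simp
qed

lemma graph_aut_id: "id \<in> carrier (graph_aut V E)"
  by (simp add: graph_aut_def permutes_id)

lemma class_of_arc_fun_eq_iff:
  fixes u w :: "'v \<times> 'v \<Rightarrow> 'k::field"
  assumes "connected_graph V E" "antisymmetric_arc_fun E u" "antisymmetric_arc_fun E w"
  shows "class_of_arc_fun V E w = class_of_arc_fun V E u \<longleftrightarrow>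
    (\<exists>\<mu>. (\<forall>a. \<mu> a \<noteq> 0) \<and> (\<forall>a b. {a, b} \<in> E \<longrightarrow> w (a, b) / u (a, b) = \<mu> a / \<mu> b))"
proof -
  have "class_of_arc_fun V E u = H1_act V E id (class_of_arc_fun V E u)"
    by (subst class_eq_H1_act_iff[OF assms(1) graph_aut_id assms(2,2)])
      (auto intro!: exI[of _ "\<lambda>_. 1"] simp: antisymmetric_arc_funD(1)[OF assms(2)])
  then show ?thesis
    using class_eq_H1_act_iff[OF assms(1) graph_aut_id assms(2,3)] by simp
qed

text \<open>Weights with \<open>x a b / x b a = u (a, b)\<close> are obtained by concentrating \<open>u\<close> on one arc of each
  edge. The quotients computed from the normalised weights differ from \<open>u\<close> by a rescaling at the
  vertices.\<close>

lemma szc_class_surj: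
  fixes f :: "_ \<Rightarrow> 'k::field"
  assumes conn: "connected_graph V E" and f: "f \<in> H1 V E"
  shows "\<exists>v\<in>SZC E. szc_class V E v = f"
proof -
  obtain u where u: "antisymmetric_arc_fun E u" "class_of_arc_fun V E u = f"
    using H1_from_arc_fun[OF conn f] by blast
  \<comment> \<open>The choice depends on the unordered pair only, so it orients every edge.\<close>
  define x where "x a b = (if (SOME z. z \<in> {a, b}) = a then u (a, b) else 1)" for a b
  define v where "v a b c = (if {a, b} \<in> E \<and> {a, c} \<in> E then x a b / x a c else undefined)" for a b c
  have x: "x a b \<noteq> 0" for a b
    using antisymmetric_arc_funD(1)[OF u(1)] by (simp add: x_def)
  have v: "v \<in> SZC E"
    using weight_ratios_in_SZC[of E x] x unfolding v_def by blast
  have "szc_arc_fun E v (a, b) / u (a, b) = inverse (x a (neighbour E a)) / inverse (x b (neighbour E b))"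
    if e: "{a, b} \<in> E" for a b
  proof -
    have e': "{b, a} \<in> E" using e by (simp add: insert_commute)
    have "(SOME z. z \<in> {a, b}) = a \<or> (SOME z. z \<in> {a, b}) = b"
      using someI[of "\<lambda>z. z \<in> {a, b}" a] by auto
    moreover have "u (a, b) * u (b, a) = 1" by (rule antisymmetric_arc_funD(2)[OF u(1) e])
    moreover have "a \<noteq> b"
      using conn edge_endpoints(3)[OF _ e] by (auto simp: connected_graph_def)
    ultimately have "x a b = u (a, b) * x b a"
      by (auto simp: x_def insert_commute)
    moreover have "szc_arc_fun E v (a, b) =
        (x a b / x a (neighbour E a)) / (x b a / x b (neighbour E b))"
      using e e' neighbour_edge[OF e] neighbour_edge[OF e']
      by (simp add: szc_arc_fun_def szc_weight_def v_def)
    ultimately show ?thesis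
      using x antisymmetric_arc_funD(1)[OF u(1)] by (simp add: field_simps)
  qed
  then have "szc_class V E v = class_of_arc_fun V E u"
    by (subst class_of_arc_fun_eq_iff[OF conn u(1) szc_arc_fun_antisymmetric[OF v]])
      (auto intro!: exI[of _ "\<lambda>a. inverse (x a (neighbour E a))"] simp: x)
  with u(2) v show ?thesis by blast
qed

lemma szc_class_image: "connected_graph V E \<Longrightarrow> szc_class V E ` SZC E = H1 V E"
  using szc_class_surj class_of_arc_fun_H1[OF szc_arc_fun_antisymmetric] by fast

lemma szc_twist_refl: "szc_twist E id v v"
  by (rule szc_twistI[where d = "\<lambda>_ _. 1"]) auto

lemma szc_twist_sym:
  assumes G: "simple_graph V E" and \<sigma>: "\<sigma> \<in> carrier (graph_aut V E)" and t: "szc_twist E \<sigma> v w"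
  shows "szc_twist E (inv_into UNIV \<sigma>) w v"
proof -
  obtain d where d: "\<And>a b. {a, b} \<in> E \<Longrightarrow> d a b \<noteq> 0"
    "\<And>a b. {a, b} \<in> E \<Longrightarrow> d a b = d b a"
    "\<And>a b c. {a, b} \<in> E \<Longrightarrow> {a, c} \<in> E \<Longrightarrow>
      w (\<sigma> a) (\<sigma> b) (\<sigma> c) * d a b = v a b c * d a c"
    using t by (rule szc_twistE) blast
  let ?\<tau> = "inv_into UNIV \<sigma>"
  have inv: "\<sigma> (?\<tau> a) = a" for a
    using \<sigma> permutes_inverses(1)[of \<sigma> V a] by (simp add: graph_aut_def)
  have E: "{?\<tau> a, ?\<tau> b} \<in> E" if "{a, b} \<in> E" for a b
    using that graph_aut_edge_iff[OF G graph_aut_inv[OF G \<sigma>]] by blast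
  show ?thesis
  proof (rule szc_twistI[where d = "\<lambda>a b. inverse (d (?\<tau> a) (?\<tau> b))"])
    fix a b c assume e: "{a, b} \<in> E" "{a, c} \<in> E"
    show "v (?\<tau> a) (?\<tau> b) (?\<tau> c) * inverse (d (?\<tau> a) (?\<tau> b)) = w a b c * inverse (d (?\<tau> a) (?\<tau> c))"
      using d(3)[OF E[OF e(1)] E[OF e(2)]] d(1)[OF E[OF e(1)]] d(1)[OF E[OF e(2)]]
      by (simp add: inv field_simps)
  next
    fix a b assume e: "{a, b} \<in> E"
    show "inverse (d (?\<tau> a) (?\<tau> b)) \<noteq> 0" using d(1)[OF E[OF e]] by simp
    show "inverse (d (?\<tau> a) (?\<tau> b)) = inverse (d (?\<tau> b) (?\<tau> a))" using d(2)[OF E[OF e]] by simp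
  qed
qed

lemma szc_twist_trans:
  assumes G: "simple_graph V E" and \<sigma>: "\<sigma> \<in> carrier (graph_aut V E)"
    and "szc_twist E \<sigma> v w" "szc_twist E \<tau> w z"
  shows "szc_twist E (\<tau> \<circ> \<sigma>) v z"
proof -
  obtain d where d: "\<And>a b. {a, b} \<in> E \<Longrightarrow> d a b \<noteq> 0"
    "\<And>a b. {a, b} \<in> E \<Longrightarrow> d a b = d b a"
    "\<And>a b c. {a, b} \<in> E \<Longrightarrow> {a, c} \<in> E \<Longrightarrow>
      w (\<sigma> a) (\<sigma> b) (\<sigma> c) * d a b = v a b c * d a c"
    using assms(3) by (rule szc_twistE) blast
  obtain d' where d': "\<And>a b. {a, b} \<in> E \<Longrightarrow> d' a b \<noteq> 0"
    "\<And>a b. {a, b} \<in> E \<Longrightarrow> d' a b = d' b a"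
    "\<And>a b c. {a, b} \<in> E \<Longrightarrow> {a, c} \<in> E \<Longrightarrow>
      z (\<tau> a) (\<tau> b) (\<tau> c) * d' a b = w a b c * d' a c"
    using assms(4) by (rule szc_twistE) blast
  have E: "{\<sigma> a, \<sigma> b} \<in> E" if "{a, b} \<in> E" for a b
    using that graph_aut_edge_iff[OF G \<sigma>] by blast
  show ?thesis
  proof (rule szc_twistI[where d = "\<lambda>a b. d a b * d' (\<sigma> a) (\<sigma> b)"])
    fix a b assume e: "{a, b} \<in> E"
    show "d a b * d' (\<sigma> a) (\<sigma> b) \<noteq> 0" using d(1)[OF e] d'(1)[OF E[OF e]] by simp
    show "d a b * d' (\<sigma> a) (\<sigma> b) = d b a * d' (\<sigma> b) (\<sigma> a)"
      using d(2)[OF e] d'(2)[OF E[OF e]] by simp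
  next
    fix a b c assume e: "{a, b} \<in> E" "{a, c} \<in> E"
    have "z (\<tau> (\<sigma> a)) (\<tau> (\<sigma> b)) (\<tau> (\<sigma> c)) * d' (\<sigma> a) (\<sigma> b) * d a b =
        w (\<sigma> a) (\<sigma> b) (\<sigma> c) * d a b * d' (\<sigma> a) (\<sigma> c)"
      using d'(3)[OF E[OF e(1)] E[OF e(2)]] by (simp add: ac_simps)
    also have "\<dots> = v a b c * d a c * d' (\<sigma> a) (\<sigma> c)"
      using d(3)[OF e] by simp
    finally show "z ((\<tau> \<circ> \<sigma>) a) ((\<tau> \<circ> \<sigma>) b) ((\<tau> \<circ> \<sigma>) c) * (d a b * d' (\<sigma> a) (\<sigma> b)) =
        v a b c * (d a c * d' (\<sigma> a) (\<sigma> c))"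
      by (simp add: ac_simps)
  qed
qed

definition szc_equiv ::
  "'v set \<Rightarrow> 'v set set \<Rightarrow> ('v \<Rightarrow> 'v \<Rightarrow> 'v \<Rightarrow> 'k::field) \<Rightarrow> ('v \<Rightarrow> 'v \<Rightarrow> 'v \<Rightarrow> 'k) \<Rightarrow> bool" where
  "szc_equiv V E v w \<longleftrightarrow> (\<exists>\<sigma>\<in>carrier (graph_aut V E). szc_twist E \<sigma> v w)"

lemma szc_equiv_refl: "szc_equiv V E v v"
  unfolding szc_equiv_def using szc_twist_refl graph_aut_id by blast

lemma szc_equiv_sym: "simple_graph V E \<Longrightarrow> szc_equiv V E v w \<Longrightarrow> szc_equiv V E w v"
  unfolding szc_equiv_def using szc_twist_sym graph_aut_inv by blast

lemma szc_equiv_trans: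
  "simple_graph V E \<Longrightarrow> szc_equiv V E v w \<Longrightarrow> szc_equiv V E w z \<Longrightarrow> szc_equiv V E v z"
  unfolding szc_equiv_def using szc_twist_trans graph_aut_comp by metis

text \<open>The action on classes is induced by transporting the coefficients along \<open>\<sigma>\<close>.\<close>

lemma H1_act_szc_class:
  fixes v :: "'v \<Rightarrow> 'v \<Rightarrow> 'v \<Rightarrow> 'k::field"
  assumes conn: "connected_graph V E" and \<sigma>: "\<sigma> \<in> carrier (graph_aut V E)" and v: "v \<in> SZC E"
  obtains w where "w \<in> SZC E" "szc_twist E \<sigma> v w" "H1_act V E \<sigma> (szc_class V E v) = szc_class V E w"
proof -
  let ?\<tau> = "inv_into UNIV \<sigma>"
  have G: "simple_graph V E" using conn by (simp add: connected_graph_def)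
  define w where "w a b c = v (?\<tau> a) (?\<tau> b) (?\<tau> c)" for a b c
  have E: "{?\<tau> a, ?\<tau> b} \<in> E \<longleftrightarrow> {a, b} \<in> E" for a b
    by (rule graph_aut_edge_iff[OF G graph_aut_inv[OF G \<sigma>]])
  have w: "w \<in> SZC E"
    unfolding SZC_def w_def mem_Collect_eq
    by (intro conjI allI impI) (simp_all add: SZC_D[OF v] E)
  have "?\<tau> (\<sigma> a) = a" for a
    using \<sigma> permutes_inverses(2)[of \<sigma> V a] by (simp add: graph_aut_def)
  then have t: "szc_twist E \<sigma> v w"
    by (intro szc_twistI[where d = "\<lambda>_ _. 1"]) (auto simp: w_def)
  then show thesis
    using that[OF w t] szc_class_eq_iff_twist[OF conn \<sigma> v w] by simp
qed

lemma orbit_szc_class_eq_iff: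
  fixes v w :: "'v \<Rightarrow> 'v \<Rightarrow> 'v \<Rightarrow> 'k::field"
  assumes conn: "connected_graph V E" and v: "v \<in> SZC E" and w: "w \<in> SZC E"
  shows "orbit (graph_aut V E) (H1_act V E) (szc_class V E v) =
    orbit (graph_aut V E) (H1_act V E) (szc_class V E w) \<longleftrightarrow> szc_equiv V E v w"
proof -
  have G: "simple_graph V E" using conn by (simp add: connected_graph_def)
  have orb: "orbit (graph_aut V E) (H1_act V E) (szc_class V E v) =
      {szc_class V E w | w. w \<in> SZC E \<and> szc_equiv V E v w}"
    if v: "v \<in> SZC E" for v :: "'v \<Rightarrow> 'v \<Rightarrow> 'v \<Rightarrow> 'k"
  proof (intro equalityI subsetI)
    fix f assume "f \<in> orbit (graph_aut V E) (H1_act V E) (szc_class V E v)"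
    then obtain \<sigma> where \<sigma>: "\<sigma> \<in> carrier (graph_aut V E)" "f = H1_act V E \<sigma> (szc_class V E v)"
      by (auto simp: orbit_def)
    obtain w where "w \<in> SZC E" "szc_twist E \<sigma> v w" "f = szc_class V E w"
      using H1_act_szc_class[OF conn \<sigma>(1) v] \<sigma>(2) by metis
    with \<sigma>(1) show "f \<in> {szc_class V E w | w. w \<in> SZC E \<and> szc_equiv V E v w}"
      by (auto simp: szc_equiv_def)
  next
    fix f assume "f \<in> {szc_class V E w | w. w \<in> SZC E \<and> szc_equiv V E v w}"
    then show "f \<in> orbit (graph_aut V E) (H1_act V E) (szc_class V E v)"
      using szc_class_eq_iff_twist[OF conn _ v] by (auto simp: szc_equiv_def orbit_def)
  qed
  show ?thesis
  proof
    assume eq: "orbit (graph_aut V E) (H1_act V E) (szc_class V E v) =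
      orbit (graph_aut V E) (H1_act V E) (szc_class V E w)"
    have "szc_class V E w \<in> orbit (graph_aut V E) (H1_act V E) (szc_class V E v)"
      unfolding eq orb[OF w] using w szc_equiv_refl by blast
    then show "szc_equiv V E v w"
      using szc_class_eq_iff_twist[OF conn _ v w] by (auto simp: szc_equiv_def orbit_def)
  next
    assume "szc_equiv V E v w"
    then have "szc_equiv V E v z \<longleftrightarrow> szc_equiv V E w z" for z
      using szc_equiv_trans[OF G] szc_equiv_sym[OF G] by blast
    then show "orbit (graph_aut V E) (H1_act V E) (szc_class V E v) =
      orbit (graph_aut V E) (H1_act V E) (szc_class V E w)"
      by (simp add: orb v w)
  qed
qed

lemma orbits_H1:
  assumes "connected_graph V E"
  shows "orbits (graph_aut V E) (H1 V E) (H1_act V E) =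
    (\<lambda>v. orbit (graph_aut V E) (H1_act V E) (szc_class V E v)) ` (SZC E)"
  unfolding szc_class_image[OF assms, symmetric] by (auto simp: orbits_def)

section \<open>The path algebra\<close>

abbreviation scale :: "'k::field \<Rightarrow> ('a \<Rightarrow>\<^sub>0 'k) \<Rightarrow> ('a \<Rightarrow>\<^sub>0 'k)" where
  "scale c \<equiv> Poly_Mapping.map ((*) c)"

lemma lookup_scale [simp]: "Poly_Mapping.lookup (scale c f) p = c * Poly_Mapping.lookup f p"
  by (simp add: Poly_Mapping.map.rep_eq when_def)

lemma scale_add: "scale c (f + g) = scale c f + scale c g"
  by (rule poly_mapping_eqI) (simp add: lookup_add distrib_left)

lemma scale_diff: "scale c (f - g) = scale c f - scale c g"
  by (rule poly_mapping_eqI) (simp add: lookup_minus right_diff_distrib)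

lemma scale_single [simp]: "scale c (Poly_Mapping.single p x) = Poly_Mapping.single p (c * x)"
  by (rule poly_mapping_eqI) (simp add: lookup_single when_def)

lemma scale_0 [simp]: "scale c 0 = 0"
  by (rule poly_mapping_eqI) simp

lemma keys_scale: "Poly_Mapping.keys (scale c f) \<subseteq> Poly_Mapping.keys f"
  by (auto simp: in_keys_iff)

lemma poly_mapping_single_induct [consumes 1, case_names zero single add]:
  fixes f :: "'a \<Rightarrow>\<^sub>0 'k::comm_monoid_add"
  assumes "Poly_Mapping.keys f \<subseteq> S" "P 0"
    and "\<And>p x. p \<in> S \<Longrightarrow> P (Poly_Mapping.single p x)"
    and "\<And>f g. P f \<Longrightarrow> P g \<Longrightarrow> P (f + g)"
  shows "P f"
proof -
  let ?s = "\<lambda>A. \<Sum>p\<in>A. Poly_Mapping.single p (Poly_Mapping.lookup f p)"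
  have "P (?s A)" if "A \<subseteq> S" "finite A" for A
    using that(2,1) by (induction A rule: finite_induct) (auto intro: assms)
  moreover have "?s (Poly_Mapping.keys f) = f"
    by (rule poly_mapping_eqI)
      (simp add: lookup_sum lookup_single when_def sum.delta in_keys_iff)
  ultimately show ?thesis using assms(1) finite_keys[of f] by metis
qed

text \<open>Bilinear and linear maps given on paths are sums over supports; their additivity is
  a matter of enlarging the index set, which is done once here.\<close>

definition lin_ext :: "('a \<Rightarrow> 'k::zero \<Rightarrow> 'b::ab_group_add) \<Rightarrow> ('a \<Rightarrow>\<^sub>0 'k) \<Rightarrow> 'b" where
  "lin_ext F f = (\<Sum>p\<in>Poly_Mapping.keys f. F p (Poly_Mapping.lookup f p))"

lemma lin_ext_add:
  fixes F :: "'a \<Rightarrow> 'k::ab_group_add \<Rightarrow> 'b::ab_group_add"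
  assumes F: "\<And>p x y. F p (x + y) = F p x + F p y"
  shows "lin_ext F (f + g) = lin_ext F f + lin_ext F g"
proof -
  let ?A = "Poly_Mapping.keys f \<union> Poly_Mapping.keys g"
  have F0: "F p 0 = 0" for p using F[of p 0 0] by simp
  have sup: "lin_ext F h = (\<Sum>p\<in>?A. F p (Poly_Mapping.lookup h p))"
    if "Poly_Mapping.keys h \<subseteq> ?A" for h
    unfolding lin_ext_def
    by (rule sum.mono_neutral_left) (use that F0 in \<open>auto simp: in_keys_iff\<close>)
  show ?thesis
    using sup[of f] sup[of g] sup[OF keys_add] by (simp add: lookup_add F sum.distrib)
qed

lemma lin_ext_single [simp]: "F p 0 = 0 \<Longrightarrow> lin_ext F (Poly_Mapping.single p x) = F p x"
  by (simp add: lin_ext_def)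

lemma lin_ext_0 [simp]: "lin_ext F 0 = 0"
  by (simp add: lin_ext_def)

definition path_term :: "'v list \<Rightarrow> 'v list \<Rightarrow> 'k::field \<Rightarrow> ('v list \<Rightarrow>\<^sub>0 'k)" where
  "path_term p q x = (if last p = hd q then Poly_Mapping.single (p @ tl q) x else 0)"

lemma path_term_add: "path_term p q (x + y) = path_term p q x + path_term p q y"
  by (simp add: path_term_def single_add)

lemma path_mult_lin_ext:
  "path_mult f g = lin_ext (\<lambda>p x. lin_ext (\<lambda>q y. path_term p q (x * y)) g) f"
  by (simp add: path_mult_def lin_ext_def path_term_def)

lemma path_mult_add_left: "path_mult (f + f') g = path_mult f g + path_mult f' g"
  unfolding path_mult_lin_ext
  by (rule lin_ext_add) (simp add: lin_ext_def distrib_right path_term_add sum.distrib)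

lemma path_mult_add_right: "path_mult f (g + g') = path_mult f g + path_mult f g'"
proof -
  have "lin_ext (\<lambda>q y. path_term p q (x * y)) (g + g') =
      lin_ext (\<lambda>q y. path_term p q (x * y)) g + lin_ext (\<lambda>q y. path_term p q (x * y)) g'" for p x
    by (rule lin_ext_add) (simp add: distrib_left path_term_add)
  then show ?thesis unfolding path_mult_lin_ext by (simp add: lin_ext_def sum.distrib)
qed

lemma path_mult_0 [simp]: "path_mult 0 g = 0" "path_mult f 0 = 0"
  by (simp_all add: path_mult_def)

lemma path_mult_single:
  "path_mult (Poly_Mapping.single p x) (Poly_Mapping.single q y) = path_term p q (x * y)"
  unfolding path_mult_lin_ext by (simp add: lin_ext_def path_term_def)

lemma path_mult_sum_left: "path_mult (sum f A) g = (\<Sum>a\<in>A. path_mult (f a) g)"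
  by (induction A rule: infinite_finite_induct) (auto simp: path_mult_add_left)

lemma path_mult_sum_right: "path_mult f (sum g A) = (\<Sum>a\<in>A. path_mult f (g a))"
  by (induction A rule: infinite_finite_induct) (auto simp: path_mult_add_right)

lemma scale_path_mult: "path_mult (scale c f) g = scale c (path_mult f g)"
proof (rule poly_mapping_single_induct[of f UNIV])
  show "path_mult (scale c (Poly_Mapping.single p x)) g = scale c (path_mult (Poly_Mapping.single p x) g)"
    for p x
    by (rule poly_mapping_single_induct[of g UNIV])
      (auto simp: path_mult_add_right scale_add path_mult_single path_term_def mult.assoc)
qed (auto simp: path_mult_add_left scale_add)

lemma paths_nonempty: "p \<in> paths V E \<Longrightarrow> p \<noteq> []"
  by (simp add: paths_def)

lemma paths_concat:
  assumes "p \<in> paths V E" "q \<in> paths V E" "last p = hd q"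
  shows "p @ tl q \<in> paths V E"
  using assms by (cases q; cases "tl q") (auto simp: paths_def successively_append_iff)

lemma hd_concat: "p \<noteq> [] \<Longrightarrow> hd (p @ r) = hd p"
  by simp

lemma last_concat: "q \<noteq> [] \<Longrightarrow> last p = hd q \<Longrightarrow> last (p @ tl q) = last q"
  by (cases q; cases "tl q") auto

lemma path_mult_assoc:
  assumes "Poly_Mapping.keys f \<subseteq> paths V E" "Poly_Mapping.keys g \<subseteq> paths V E"
    "Poly_Mapping.keys h \<subseteq> paths V E"
  shows "path_mult (path_mult f g) h = path_mult f (path_mult g h)"
  using assms(1)
proof (induction f rule: poly_mapping_single_induct)
  case (single p x)
  show ?case using assms(2)
  proof (induction g rule: poly_mapping_single_induct)
    case (single q y)
    show ?case using assms(3)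
    proof (induction h rule: poly_mapping_single_induct)
      case (single r z)
      then show ?case
        using \<open>p \<in> paths V E\<close> \<open>q \<in> paths V E\<close>
        by (auto simp: path_mult_single path_term_def last_concat hd_concat mult.assoc
            dest!: paths_nonempty)
    qed (auto simp: path_mult_add_right)
  qed (auto simp: path_mult_add_left path_mult_add_right)
qed (auto simp: path_mult_add_left)

lemma keys_path_mult:
  assumes "Poly_Mapping.keys f \<subseteq> paths V E" "Poly_Mapping.keys g \<subseteq> paths V E"
  shows "Poly_Mapping.keys (path_mult f g) \<subseteq> paths V E"
  using assms(1)
proof (induction f rule: poly_mapping_single_induct)
  case (single p x)
  show ?case using assms(2)
  proof (induction g rule: poly_mapping_single_induct)
    case (single q y)
    then show ?case
      using \<open>p \<in> paths V E\<close> paths_concat[of p V E q] by (simp add: path_mult_single path_term_def)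
  next
    case (add g g')
    then show ?case by (simp add: path_mult_add_right) (meson keys_add Un_least subset_trans)
  qed simp
next
  case (add f f')
  then show ?case by (simp add: path_mult_add_left) (meson keys_add Un_least subset_trans)
qed simp

abbreviation path_one :: "'v set \<Rightarrow> ('v list \<Rightarrow>\<^sub>0 'k::field)" where
  "path_one V \<equiv> \<Sum>a\<in>V. Poly_Mapping.single [a] 1"

lemma path_mult_one:
  assumes "finite V" "Poly_Mapping.keys f \<subseteq> paths V E"
  shows "path_mult (path_one V) f = f" "path_mult f (path_one V) = f"
proof -
  have "path_mult (path_one V) (Poly_Mapping.single p x) = Poly_Mapping.single p x \<and>
      path_mult (Poly_Mapping.single p x) (path_one V) = Poly_Mapping.single p x"
    if path: "p \<in> paths V E" for p :: "'a list" and x :: 'b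
  proof -
    obtain b q where p: "p = b # q" using paths_nonempty[OF path] by (cases p) auto
    have V: "hd p \<in> V" "last p \<in> V"
      using path paths_nonempty[OF path] by (auto simp: paths_def)
    have "path_mult (path_one V) (Poly_Mapping.single p x) =
        (\<Sum>a\<in>V. if a = hd p then Poly_Mapping.single p x else 0)"
      unfolding path_mult_sum_left
      by (rule sum.cong) (auto simp: path_mult_single path_term_def p)
    moreover have "path_mult (Poly_Mapping.single p x) (path_one V) =
        (\<Sum>a\<in>V. if a = last p then Poly_Mapping.single p x else 0)"
      unfolding path_mult_sum_right
      by (rule sum.cong) (auto simp: path_mult_single path_term_def)
    ultimately show ?thesis using V assms(1) by (simp add: sum.delta)
  qed
  note monomial = this
  have "path_mult (path_one V) f = f \<and> path_mult f (path_one V) = f"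
    using assms(2)
  proof (induction f rule: poly_mapping_single_induct)
    case (single p x)
    then show ?case by (rule monomial)
  qed (simp_all add: path_mult_add_right path_mult_add_left)
  then show "path_mult (path_one V) f = f" "path_mult f (path_one V) = f" by simp_all
qed

lemma path_algebra_simps:
  "carrier (path_algebra V E) = {f. Poly_Mapping.keys f \<subseteq> paths V E}"
  "x \<otimes>\<^bsub>path_algebra V E\<^esub> y = path_mult x y"
  "\<one>\<^bsub>path_algebra V E\<^esub> = path_one V"
  "\<zero>\<^bsub>path_algebra V E\<^esub> = 0"
  "x \<oplus>\<^bsub>path_algebra V E\<^esub> y = x + y"
  "c \<odot>\<^bsub>path_algebra V E\<^esub> x = scale c x"
  "component (path_algebra V E) n =
    {f. Poly_Mapping.keys f \<subseteq> {p \<in> paths V E. path_length p = n}}"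
  by (simp_all add: path_algebra_def)

lemma keys_path_one: "Poly_Mapping.keys (path_one V :: _ \<Rightarrow>\<^sub>0 'k::field) \<subseteq> paths V E"
  using keys_sum[of "\<lambda>a. Poly_Mapping.single [a] (1::'k)" V] by (auto simp: paths_def)

lemma ring_path_algebra:
  assumes "finite V"
  shows "ring (path_algebra V E :: ('k::field, 'v list \<Rightarrow>\<^sub>0 'k) graded_algebra)"
proof (rule ringI)
  show "abelian_group (path_algebra V E :: ('k, 'v list \<Rightarrow>\<^sub>0 'k) graded_algebra)"
  proof (rule abelian_groupI)
    fix x :: "'v list \<Rightarrow>\<^sub>0 'k" assume "x \<in> carrier (path_algebra V E)"
    then show "\<exists>y\<in>carrier (path_algebra V E). y \<oplus>\<^bsub>path_algebra V E\<^esub> x = \<zero>\<^bsub>path_algebra V E\<^esub>"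
      by (intro bexI[of _ "- x"]) (simp_all add: path_algebra_simps)
  next
    fix x y :: "'v list \<Rightarrow>\<^sub>0 'k"
    assume "x \<in> carrier (path_algebra V E)" "y \<in> carrier (path_algebra V E)"
    then show "x \<oplus>\<^bsub>path_algebra V E\<^esub> y \<in> carrier (path_algebra V E)"
      using keys_add[of x y] by (auto simp: path_algebra_simps)
  qed (auto simp: path_algebra_simps ac_simps)
  show "monoid (path_algebra V E :: ('k, 'v list \<Rightarrow>\<^sub>0 'k) graded_algebra)"
    by (rule monoidI)
      (simp_all add: path_algebra_simps keys_path_mult path_mult_assoc path_mult_one assms keys_path_one)
qed (simp_all add: path_algebra_simps path_mult_add_left path_mult_add_right)

text \<open>A path is a concatenation of two paths once for each of its vertices, at which it is cut.\<close>

lemma lookup_path_mult: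
  assumes "Poly_Mapping.keys f \<subseteq> paths V E" "Poly_Mapping.keys g \<subseteq> paths V E"
  shows "Poly_Mapping.lookup (path_mult f g) r =
    (\<Sum>i<length r. Poly_Mapping.lookup f (take (Suc i) r) * Poly_Mapping.lookup g (drop i r))"
  using assms(1)
proof (induction f rule: poly_mapping_single_induct)
  case (single p x)
  show ?case using assms(2)
  proof (induction g rule: poly_mapping_single_induct)
    case (single q y)
    have ne: "p \<noteq> []" "q \<noteq> []"
      using \<open>p \<in> paths V E\<close> \<open>q \<in> paths V E\<close> by (auto simp: paths_def)
    have split: "p = take (Suc i) r \<and> q = drop i r \<longleftrightarrow>
        i = length p - 1 \<and> last p = hd q \<and> p @ tl q = r" if "i < length r" for i
    proof
      assume "p = take (Suc i) r \<and> q = drop i r"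
      then show "i = length p - 1 \<and> last p = hd q \<and> p @ tl q = r"
        using Cons_nth_drop_Suc[OF that] take_Suc_conv_app_nth[OF that] append_take_drop_id[of i r] that
        by (metis One_nat_def append.assoc append_Cons append_Nil diff_Suc_1 last_snoc
            length_append_singleton length_take less_imp_le list.sel(1,3) min.absorb2)
    next
      assume *: "i = length p - 1 \<and> last p = hd q \<and> p @ tl q = r"
      then have "p = take (Suc i) r" using ne by auto
      moreover have "drop i r = last p # tl q"
        using * ne by (cases p rule: rev_cases) auto
      ultimately show "p = take (Suc i) r \<and> q = drop i r" using * ne by simp
    qed
    let ?C = "last p = hd q \<and> p @ tl q = r"
    have "Poly_Mapping.lookup (Poly_Mapping.single p x) (take (Suc i) r) *
        Poly_Mapping.lookup (Poly_Mapping.single q y) (drop i r) =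
        (if p = take (Suc i) r \<and> q = drop i r then x * y else 0)" for i
      by (simp add: lookup_single when_def)
    moreover have "(if p = take (Suc i) r \<and> q = drop i r then x * y else 0) =
        (if i = length p - 1 then if ?C then x * y else 0 else 0)" if "i < length r" for i
      unfolding split[OF that] by simp
    ultimately have "(\<Sum>i<length r. Poly_Mapping.lookup (Poly_Mapping.single p x) (take (Suc i) r) *
        Poly_Mapping.lookup (Poly_Mapping.single q y) (drop i r)) =
      (\<Sum>i<length r. if i = length p - 1 then (if ?C then x * y else 0) else 0)"
      by (intro sum.cong refl) auto
    also have "\<dots> = (if last p = hd q \<and> p @ tl q = r then x * y else 0)"
      using ne by (cases p) (auto simp: sum.delta)
    finally show ?case
      by (simp add: path_mult_single path_term_def lookup_single when_def)
  qed (simp_all add: path_mult_add_right lookup_add distrib_left sum.distrib)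
qed (simp_all add: path_mult_add_left lookup_add distrib_right sum.distrib)

lemma lookup_path_mult_short:
  assumes "Poly_Mapping.keys f \<subseteq> paths V E" "Poly_Mapping.keys g \<subseteq> paths V E"
  shows "Poly_Mapping.lookup (path_mult f g) [a] = Poly_Mapping.lookup f [a] * Poly_Mapping.lookup g [a]"
    and "Poly_Mapping.lookup (path_mult f g) [a, b] =
      Poly_Mapping.lookup f [a] * Poly_Mapping.lookup g [a, b] +
      Poly_Mapping.lookup f [a, b] * Poly_Mapping.lookup g [b]"
    and "Poly_Mapping.lookup (path_mult f g) [a, b, c] =
      Poly_Mapping.lookup f [a] * Poly_Mapping.lookup g [a, b, c] +
      Poly_Mapping.lookup f [a, b] * Poly_Mapping.lookup g [b, c] +
      Poly_Mapping.lookup f [a, b, c] * Poly_Mapping.lookup g [c]"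
  by (simp_all add: lookup_path_mult[OF assms] eval_nat_numeral)


section \<open>Quotient algebras\<close>

text \<open>The ideals for which the scalar multiplication descends to the quotient. For the path algebra
  this holds for all ideals, since scalars can be multiplied into the identity.\<close>

locale graded_algebra_ideal = ideal I A
  for I and A :: "('k, 'b) graded_algebra" (structure) +
  assumes smult_closed: "x \<in> carrier A \<Longrightarrow> c \<odot> x \<in> carrier A"
    and smult_add: "\<lbrakk>x \<in> carrier A; y \<in> carrier A\<rbrakk> \<Longrightarrow> c \<odot> (x \<oplus> y) = c \<odot> x \<oplus> c \<odot> y"
    and I_smult_closed: "x \<in> I \<Longrightarrow> c \<odot> x \<in> I"
begin

lemma coset_eq_iff:
  assumes "x \<in> carrier A" "y \<in> carrier A"
  shows "I +> x = I +> y \<longleftrightarrow> x \<ominus> y \<in> I"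
  using quotient_eq_iff_same_a_r_cos[OF ideal_axioms assms] by simp

lemma quot_algebra_simps:
  "carrier (quot_algebra A I) = (\<lambda>x. I +> x) ` carrier A"
  "\<one>\<^bsub>quot_algebra A I\<^esub> = I +> \<one>"
  "component (quot_algebra A I) n = (\<lambda>x. I +> x) ` component A n"
  by (auto simp: quot_algebra_def FactRing_def A_RCOSETS_def')

lemma quot_algebra_mult:
  "\<lbrakk>x \<in> carrier A; y \<in> carrier A\<rbrakk> \<Longrightarrow> (I +> x) \<otimes>\<^bsub>quot_algebra A I\<^esub> (I +> y) = I +> (x \<otimes> y)"
  by (simp add: quot_algebra_def FactRing_def rcoset_mult_add)

lemma quot_algebra_add:
  "\<lbrakk>x \<in> carrier A; y \<in> carrier A\<rbrakk> \<Longrightarrow> (I +> x) \<oplus>\<^bsub>quot_algebra A I\<^esub> (I +> y) = I +> (x \<oplus> y)"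
  by (simp add: quot_algebra_def FactRing_def a_rcos_sum)

lemma quot_algebra_smult:
  assumes x: "x \<in> carrier A"
  shows "c \<odot>\<^bsub>quot_algebra A I\<^esub> (I +> x) = I +> (c \<odot> x)"
proof -
  have "I +> (c \<odot> y) = I +> (c \<odot> x)" if y: "y \<in> I +> x" for y
  proof -
    obtain i where i: "i \<in> I" "y = i \<oplus> x" using y by (auto simp: a_r_coset_def')
    then have "c \<odot> y = c \<odot> i \<oplus> c \<odot> x" using x by (simp add: smult_add)
    moreover have "(c \<odot> i \<oplus> c \<odot> x) \<in> I +> (c \<odot> x)"
      using I_smult_closed[OF i(1)] by (auto simp: a_r_coset_def')
    ultimately show ?thesis
      using a_repr_independence'[of "c \<odot> y" "c \<odot> x"] smult_closed[OF x] by simp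
  qed
  then have "(\<Union>y\<in>I +> x. I +> (c \<odot> y)) = (\<Union>y\<in>I +> x. I +> (c \<odot> x))"
    by (intro SUP_cong refl)
  also have "\<dots> = I +> (c \<odot> x)"
    using a_rcos_self[OF x] by blast
  finally show ?thesis
    by (simp add: quot_algebra_def)
qed

end

text \<open>An isomorphism carrying one ideal onto the other maps cosets onto cosets, so its image map
  is the induced isomorphism of the quotients.\<close>

lemma graded_alg_iso_quot:
  assumes I: "graded_algebra_ideal I A" and J: "graded_algebra_ideal J B"
    and \<phi>: "\<phi> \<in> graded_alg_iso A B" "\<phi> ` I = J"
    and comp: "\<And>n. component A n \<subseteq> carrier A"
  shows "(\<lambda>X. \<phi> ` X) \<in> graded_alg_iso (quot_algebra A I) (quot_algebra B J)"
proof -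
  interpret I: graded_algebra_ideal I A by (rule I)
  interpret J: graded_algebra_ideal J B by (rule J)
  have iso: "\<phi> \<in> ring_iso A B" and smult: "\<And>c x. x \<in> carrier A \<Longrightarrow> \<phi> (c \<odot>\<^bsub>A\<^esub> x) = c \<odot>\<^bsub>B\<^esub> \<phi> x"
    and deg: "\<And>n. \<phi> ` component A n = component B n"
    using \<phi>(1) by (auto simp: graded_alg_iso_def)
  note hom = ring_iso_memE[OF iso]
  have cos: "\<phi> ` (I +>\<^bsub>A\<^esub> x) = J +>\<^bsub>B\<^esub> \<phi> x" if x: "x \<in> carrier A" for x
  proof -
    have "\<phi> ` (I +>\<^bsub>A\<^esub> x) = (\<lambda>i. \<phi> (i \<oplus>\<^bsub>A\<^esub> x)) ` I"
      by (auto simp: a_r_coset_def')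
    also have "\<dots> = (\<lambda>i. \<phi> i \<oplus>\<^bsub>B\<^esub> \<phi> x) ` I"
      using x hom(3) I.a_Hcarr by (intro image_cong) auto
    also have "\<dots> = (\<lambda>j. j \<oplus>\<^bsub>B\<^esub> \<phi> x) ` J"
      by (simp add: image_image flip: \<phi>(2))
    also have "\<dots> = J +>\<^bsub>B\<^esub> \<phi> x"
      by (auto simp: a_r_coset_def')
    finally show ?thesis .
  qed
  have cos_ops: "\<phi> ` (I +>\<^bsub>A\<^esub> (x \<otimes>\<^bsub>A\<^esub> y)) = J +>\<^bsub>B\<^esub> (\<phi> x \<otimes>\<^bsub>B\<^esub> \<phi> y)"
    "\<phi> ` (I +>\<^bsub>A\<^esub> (x \<oplus>\<^bsub>A\<^esub> y)) = J +>\<^bsub>B\<^esub> (\<phi> x \<oplus>\<^bsub>B\<^esub> \<phi> y)"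
    if "x \<in> carrier A" "y \<in> carrier A" for x y
    using that hom by (simp_all add: cos)
  have cos_smult: "\<phi> ` (I +>\<^bsub>A\<^esub> (c \<odot>\<^bsub>A\<^esub> x)) = J +>\<^bsub>B\<^esub> (c \<odot>\<^bsub>B\<^esub> \<phi> x)"
    if "x \<in> carrier A" for x c
    using that smult by (simp add: cos I.smult_closed)
  have inj: "inj_on \<phi> (carrier A)" and surj: "\<phi> ` carrier A = carrier B"
    using hom(5) by (auto simp: bij_betw_def)
  have sub: "I +>\<^bsub>A\<^esub> x \<subseteq> carrier A" if "x \<in> carrier A" for x
    using that I.a_Hcarr by (auto simp: a_r_coset_def')
  show ?thesis
    unfolding graded_alg_iso_def mem_Collect_eq
  proof (intro conjI allI ballI ring_iso_memI)
    show "bij_betw (\<lambda>X. \<phi> ` X) (carrier (quot_algebra A I)) (carrier (quot_algebra B J))"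
      unfolding bij_betw_def I.quot_algebra_simps J.quot_algebra_simps
    proof
      show "inj_on (\<lambda>X. \<phi> ` X) ((\<lambda>x. I +>\<^bsub>A\<^esub> x) ` carrier A)"
        using inj_on_image_eq_iff[OF inj] sub by (intro inj_onI) auto
      show "(\<lambda>X. \<phi> ` X) ` (\<lambda>x. I +>\<^bsub>A\<^esub> x) ` carrier A = (\<lambda>x. J +>\<^bsub>B\<^esub> x) ` carrier B"
        by (simp add: image_image cos flip: surj)
    qed
    show "(\<lambda>X. \<phi> ` X) ` component (quot_algebra A I) n = component (quot_algebra B J) n" for n
    proof -
      have "(\<lambda>X. \<phi> ` X) ` component (quot_algebra A I) n = (\<lambda>x. J +>\<^bsub>B\<^esub> \<phi> x) ` component A n"
        unfolding I.quot_algebra_simps image_image using comp[of n] by (intro image_cong cos) auto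
      then show ?thesis
        by (simp add: J.quot_algebra_simps image_image flip: deg)
    qed
  next
    fix X Y assume "X \<in> carrier (quot_algebra A I)" "Y \<in> carrier (quot_algebra A I)"
    then obtain x y where "x \<in> carrier A" "X = I +>\<^bsub>A\<^esub> x" "y \<in> carrier A" "Y = I +>\<^bsub>A\<^esub> y"
      by (auto simp: I.quot_algebra_simps)
    then show "\<phi> ` (X \<otimes>\<^bsub>quot_algebra A I\<^esub> Y) = \<phi> ` X \<otimes>\<^bsub>quot_algebra B J\<^esub> \<phi> ` Y"
      and "\<phi> ` (X \<oplus>\<^bsub>quot_algebra A I\<^esub> Y) = \<phi> ` X \<oplus>\<^bsub>quot_algebra B J\<^esub> \<phi> ` Y"
      by (simp_all add: cos cos_ops hom I.quot_algebra_mult J.quot_algebra_mult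
          I.quot_algebra_add J.quot_algebra_add)
  next
    fix c X assume "X \<in> carrier (quot_algebra A I)"
    then obtain x where "x \<in> carrier A" "X = I +>\<^bsub>A\<^esub> x"
      by (auto simp: I.quot_algebra_simps)
    then show "\<phi> ` (c \<odot>\<^bsub>quot_algebra A I\<^esub> X) = c \<odot>\<^bsub>quot_algebra B J\<^esub> \<phi> ` X"
      by (simp add: cos cos_smult hom I.quot_algebra_smult J.quot_algebra_smult)
  qed (use hom in \<open>auto simp: I.quot_algebra_simps J.quot_algebra_simps cos\<close>)
qed

lemma path_algebra_a_inv:
  assumes "finite V" "f \<in> carrier (path_algebra V E)"
  shows "\<ominus>\<^bsub>path_algebra V E\<^esub> f = - f"
proof -
  interpret ring "path_algebra V E" by (rule ring_path_algebra[OF assms(1)])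
  have "- f \<in> carrier (path_algebra V E)"
    using assms(2) by (simp add: path_algebra_simps)
  then show ?thesis
    using assms(2) minus_equality[of "- f" f] by (simp add: path_algebra_simps(4,5))
qed

lemma path_algebra_a_minus:
  assumes "finite V" "y \<in> carrier (path_algebra V E)"
  shows "x \<ominus>\<^bsub>path_algebra V E\<^esub> y = x - y"
  by (simp add: a_minus_def path_algebra_a_inv[OF assms] path_algebra_simps(5))

lemma path_algebra_ideal:
  fixes I :: "('v list \<Rightarrow>\<^sub>0 'k::field) set"
  assumes V: "finite V" and I: "ideal I (path_algebra V E)"
  shows "graded_algebra_ideal I (path_algebra V E)"
proof -
  interpret I: ideal I "path_algebra V E" by (rule I)
  show ?thesis
  proof (intro graded_algebra_ideal.intro[OF I] graded_algebra_ideal_axioms.intro)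
    fix x :: "'v list \<Rightarrow>\<^sub>0 'k" and c :: 'k assume "x \<in> carrier (path_algebra V E)"
    then show "c \<odot>\<^bsub>path_algebra V E\<^esub> x \<in> carrier (path_algebra V E)"
      using keys_scale[of c x] by (auto simp: path_algebra_simps)
  next
    fix x :: "'v list \<Rightarrow>\<^sub>0 'k" and c :: 'k assume x: "x \<in> I"
    then have xP: "Poly_Mapping.keys x \<subseteq> paths V E"
      using I.a_Hcarr[OF x] by (simp add: path_algebra_simps)
    have "Poly_Mapping.keys (scale c (path_one V)) \<subseteq> paths V E"
      using keys_scale[of c "path_one V"] keys_path_one[of V E, where ?'k = 'k] by blast
    then have "path_mult (scale c (path_one V)) x \<in> I"
      using I.I_l_closed[OF x, of "scale c (path_one V)"] by (simp add: path_algebra_simps)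
    also have "path_mult (scale c (path_one V)) x = scale c x"
      by (simp add: scale_path_mult path_mult_one[OF V xP])
    finally show "c \<odot>\<^bsub>path_algebra V E\<^esub> x \<in> I" by (simp add: path_algebra_simps)
  qed (simp add: path_algebra_simps scale_add)
qed

section \<open>Isomorphisms from graph automorphisms\<close>

fun path_weight :: "('v \<Rightarrow> 'v \<Rightarrow> 'k::field) \<Rightarrow> 'v list \<Rightarrow> 'k" where
  "path_weight c (a # b # p) = c a b * path_weight c (b # p)"
| "path_weight c p = 1"

lemma path_weight_concat:
  assumes "q \<noteq> []" "last p = hd q" "p \<noteq> []"
  shows "path_weight c (p @ tl q) = path_weight c p * path_weight c q"
  using assms(3,2)
proof (induction p rule: induct_list012)
  case (2 a)
  then have "[a] @ tl q = q" using assms(1) by (cases q) auto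
  then show ?case by simp
qed simp_all

lemma map_path_in_paths:
  assumes "simple_graph V E" "\<sigma> \<in> carrier (graph_aut V E)" "p \<in> paths V E"
  shows "map \<sigma> p \<in> paths V E"
proof -
  have "\<sigma> permutes V" using assms(2) by (simp add: graph_aut_def)
  then show ?thesis
    using assms(3) graph_aut_edge_iff[OF assms(1,2)]
    by (auto simp: paths_def successively_map arcs_iff permutes_in_image)
qed

lemma path_weight_inverse:
  assumes "p \<in> paths V E"
    and "\<And>a b. {a, b} \<in> E \<Longrightarrow> c' (\<sigma> a) (\<sigma> b) * c a b = (1 :: 'k::field)"
  shows "path_weight c' (map \<sigma> p) * path_weight c p = 1"
proof -
  have "successively (\<lambda>a b. (a, b) \<in> arcs E) p" using assms(1) by (simp add: paths_def)
  then show ?thesis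
  proof (induction p rule: induct_list012)
    case (3 a b p)
    then have "path_weight c' (map \<sigma> (b # p)) * path_weight c (b # p) = 1" "c' (\<sigma> a) (\<sigma> b) * c a b = 1"
      using assms(2) by (auto simp: arcs_iff)
    moreover have "path_weight c' (map \<sigma> (a # b # p)) * path_weight c (a # b # p) =
        (c' (\<sigma> a) (\<sigma> b) * c a b) * (path_weight c' (map \<sigma> (b # p)) * path_weight c (b # p))"
      by (simp add: ac_simps)
    ultimately show ?case by simp
  qed simp_all
qed

text \<open>The algebra map with \<open>(a) \<mapsto> (\<sigma> a)\<close> and \<open>(a | b) \<mapsto> c a b (\<sigma> a | \<sigma> b)\<close>.\<close>

definition transport ::
  "('v \<Rightarrow> 'v) \<Rightarrow> ('v \<Rightarrow> 'v \<Rightarrow> 'k::field) \<Rightarrow> ('v list \<Rightarrow>\<^sub>0 'k) \<Rightarrow> ('v list \<Rightarrow>\<^sub>0 'k)" where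
  "transport \<sigma> c = lin_ext (\<lambda>p x. Poly_Mapping.single (map \<sigma> p) (path_weight c p * x))"

lemma transport_single [simp]:
  "transport \<sigma> c (Poly_Mapping.single p x) = Poly_Mapping.single (map \<sigma> p) (path_weight c p * x)"
  by (simp add: transport_def)

lemma transport_0 [simp]: "transport \<sigma> c 0 = 0"
  by (simp add: transport_def)

lemma transport_add: "transport \<sigma> c (f + g) = transport \<sigma> c f + transport \<sigma> c g"
  unfolding transport_def by (rule lin_ext_add) (simp add: distrib_left single_add)

lemma transport_diff: "transport \<sigma> c (f - g) = transport \<sigma> c f - transport \<sigma> c g"
  using transport_add[of \<sigma> c "f - g" g] by simp

lemma transport_sum: "transport \<sigma> c (sum f A) = (\<Sum>a\<in>A. transport \<sigma> c (f a))"
  by (induction A rule: infinite_finite_induct) (auto simp: transport_add)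

lemma transport_scale: "transport \<sigma> c (scale k f) = scale k (transport \<sigma> c f)"
  by (rule poly_mapping_single_induct[of f UNIV])
    (auto simp: transport_add scale_add mult.left_commute)

lemma keys_transport: "Poly_Mapping.keys (transport \<sigma> c f) \<subseteq> map \<sigma> ` Poly_Mapping.keys f"
  unfolding transport_def lin_ext_def
  by (rule subset_trans[OF keys_sum]) (auto split: if_splits)

lemma transport_mult:
  assumes "Poly_Mapping.keys f \<subseteq> paths V E" "Poly_Mapping.keys g \<subseteq> paths V E" "inj \<sigma>"
  shows "transport \<sigma> c (path_mult f g) = path_mult (transport \<sigma> c f) (transport \<sigma> c g)"
  using assms(1)
proof (induction f rule: poly_mapping_single_induct)
  case (single p x)
  show ?case using assms(2)
  proof (induction g rule: poly_mapping_single_induct)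
    case (single q y)
    have "p \<noteq> []" "q \<noteq> []"
      using \<open>p \<in> paths V E\<close> \<open>q \<in> paths V E\<close> by (auto simp: paths_def)
    moreover from this have "last (map \<sigma> p) = hd (map \<sigma> q) \<longleftrightarrow> last p = hd q"
      using assms(3) by (simp add: last_map hd_map inj_eq)
    ultimately show ?case
      by (simp add: path_mult_single path_term_def path_weight_concat map_tl ac_simps)
  qed (auto simp: path_mult_add_right transport_add)
qed (auto simp: path_mult_add_left transport_add)

lemma transport_inverse:
  assumes "Poly_Mapping.keys f \<subseteq> paths V E" "\<And>a. \<tau> (\<sigma> a) = a"
    and "\<And>a b. {a, b} \<in> E \<Longrightarrow> c' (\<sigma> a) (\<sigma> b) * c a b = (1 :: 'k::field)"
  shows "transport \<tau> c' (transport \<sigma> c f) = f"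
  using assms(1)
proof (induction f rule: poly_mapping_single_induct)
  case (single p x)
  have "path_weight c' (map \<sigma> p) * path_weight c p = 1"
    using single assms(3) by (rule path_weight_inverse)
  then show ?case
    by (simp add: assms(2) o_def flip: mult.assoc)
qed (auto simp: transport_add)

context
  fixes V :: "'v set" and E :: "'v set set" and \<sigma> :: "'v \<Rightarrow> 'v"
    and c :: "'v \<Rightarrow> 'v \<Rightarrow> 'k::field"
  assumes G: "simple_graph V E"
    and \<sigma>: "\<sigma> \<in> carrier (graph_aut V E)"
    and c: "\<forall>a b. {a, b} \<in> E \<longrightarrow> c a b \<noteq> 0"
begin

private abbreviation (input) "\<tau> \<equiv> inv_into UNIV \<sigma>"
private abbreviation (input) "c' \<equiv> \<lambda>a b. inverse (c (\<tau> a) (\<tau> b))"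
private abbreviation (input) "P \<equiv> path_algebra V E :: ('k, 'v list \<Rightarrow>\<^sub>0 'k) graded_algebra"

lemma aut_inverses: "\<sigma> (\<tau> a) = a" "\<tau> (\<sigma> a) = a"
  using \<sigma> permutes_inverses[of \<sigma> V a] by (auto simp: graph_aut_def)

lemma \<tau>_aut: "\<tau> \<in> carrier (graph_aut V E)"
  by (rule graph_aut_inv[OF G \<sigma>])

lemma \<tau>_edge: "{\<tau> a, \<tau> b} \<in> E \<longleftrightarrow> {a, b} \<in> E"
  by (rule graph_aut_edge_iff[OF G \<tau>_aut])

lemma keys_transport_paths:
  assumes "\<rho> \<in> carrier (graph_aut V E)" "Poly_Mapping.keys f \<subseteq> {p \<in> paths V E. Q (length p)}"
  shows "Poly_Mapping.keys (transport \<rho> k f) \<subseteq> {p \<in> paths V E. Q (length p)}"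
  using keys_transport[of \<rho> k f] assms(2) map_path_in_paths[OF G assms(1)] by fastforce

lemma transport_transport:
  assumes "Poly_Mapping.keys f \<subseteq> paths V E"
  shows "transport \<tau> c' (transport \<sigma> c f) = f" "transport \<sigma> c (transport \<tau> c' f) = f"
proof -
  show "transport \<tau> c' (transport \<sigma> c f) = f"
    by (rule transport_inverse[OF assms]) (simp_all add: aut_inverses c)
  show "transport \<sigma> c (transport \<tau> c' f) = f"
    by (rule transport_inverse[OF assms]) (simp_all add: aut_inverses c \<tau>_edge)
qed

lemma transport_image:
  "transport \<sigma> c ` {f. Poly_Mapping.keys f \<subseteq> {p \<in> paths V E. Q (length p)}} =
    {f. Poly_Mapping.keys f \<subseteq> {p \<in> paths V E. Q (length p)}}" (is "_ ` ?S = ?S")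
proof
  show "transport \<sigma> c ` ?S \<subseteq> ?S"
    using keys_transport_paths[OF \<sigma>] by blast
  show "?S \<subseteq> transport \<sigma> c ` ?S"
  proof
    fix f assume f: "f \<in> ?S"
    then have "Poly_Mapping.keys f \<subseteq> paths V E" by auto
    then have "f = transport \<sigma> c (transport \<tau> c' f)" by (simp add: transport_transport)
    moreover have "transport \<tau> c' f \<in> ?S" using keys_transport_paths[OF \<tau>_aut] f by blast
    ultimately show "f \<in> transport \<sigma> c ` ?S" by blast
  qed
qed

lemma transport_one: "transport \<sigma> c (path_one V) = path_one V"
proof -
  have "\<sigma> permutes V" using \<sigma> by (simp add: graph_aut_def)
  then have "(\<Sum>a\<in>V. Poly_Mapping.single [\<sigma> a] 1) = (path_one V :: _ \<Rightarrow>\<^sub>0 'k)"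
    using sum.permute[of \<sigma> V "\<lambda>a. Poly_Mapping.single [a] (1::'k)"] by (simp add: o_def)
  then show ?thesis by (simp add: transport_sum)
qed

lemma transport_iso: "transport \<sigma> c \<in> graded_alg_iso P P"
proof -
  have inj: "inj \<sigma>" using aut_inverses(2) by (metis injI)
  have "transport \<sigma> c \<in> ring_iso P P"
  proof (rule ring_iso_memI)
    show "bij_betw (transport \<sigma> c) (carrier P) (carrier P)"
      unfolding bij_betw_def path_algebra_simps
    proof
      show "inj_on (transport \<sigma> c) {f. Poly_Mapping.keys f \<subseteq> paths V E}"
        by (rule inj_on_inverseI[of _ "transport \<tau> c'"]) (simp add: transport_transport)
    qed (use transport_image[of "\<lambda>_. True"] in simp)
    show "transport \<sigma> c x \<in> carrier P" if "x \<in> carrier P" for x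
      using that transport_image[of "\<lambda>_. True"] by (auto simp: path_algebra_simps)
  qed (auto simp: path_algebra_simps transport_mult[OF _ _ inj] transport_add transport_one)
  then show ?thesis
    using transport_image[of "\<lambda>l. l - 1 = n" for n]
    by (simp add: graded_alg_iso_def path_algebra_simps transport_scale path_length_def)
qed

end

lemma zigzag_relations_carrier:
  fixes v :: "'v \<Rightarrow> 'v \<Rightarrow> 'v \<Rightarrow> 'k::field"
  assumes "simple_graph V E"
  shows "zigzag_relations V E v \<subseteq> carrier (path_algebra V E)"
proof -
  have "[a, b, a] \<in> paths V E" if "{a, b} \<in> E" for a b
    using that edge_endpoints[OF assms that] by (auto simp: paths_def arcs_iff insert_commute)
  then have "Poly_Mapping.keys (Poly_Mapping.single [a, b, a] x - Poly_Mapping.single [a, d, a] y) \<subseteq> paths V E"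
    if "{a, b} \<in> E" "{a, d} \<in> E" for a b d and x y :: 'k
    using that by (auto simp: in_keys_iff lookup_minus lookup_single when_def split: if_splits)
  note diff = this
  show ?thesis
    unfolding zigzag_relations_def path_algebra_simps
    by (intro Un_least subsetI; elim CollectE exE conjE; simp add: diff)
qed

abbreviation zigzag_ideal ::
  "'v set \<Rightarrow> 'v set set \<Rightarrow> ('v \<Rightarrow> 'v \<Rightarrow> 'v \<Rightarrow> 'k::field) \<Rightarrow> ('v list \<Rightarrow>\<^sub>0 'k) set" where
  "zigzag_ideal V E v \<equiv> Idl\<^bsub>path_algebra V E\<^esub> (zigzag_relations V E v)"

lemma zigzag_ideal:
  assumes "simple_graph V E"
  shows "graded_algebra_ideal (zigzag_ideal V E v) (path_algebra V E)"
proof -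
  have V: "finite V" using assms by (simp add: simple_graph_def)
  show ?thesis
    by (intro path_algebra_ideal V ring.genideal_ideal ring_path_algebra zigzag_relations_carrier assms)
qed

lemma zigzag_relations_subset_ideal: "zigzag_relations V E v \<subseteq> zigzag_ideal V E v"
  unfolding genideal_def by blast

text \<open>The assumption on \<open>c\<close> makes the image of every relation a multiple of a relation, and the
  preimage of an ideal is an ideal.\<close>

lemma transport_zigzag_ideal:
  fixes v w :: "'v \<Rightarrow> 'v \<Rightarrow> 'v \<Rightarrow> 'k::field"
  assumes G: "simple_graph V E" and \<sigma>: "\<sigma> \<in> carrier (graph_aut V E)"
    and c: "\<forall>a b. {a, b} \<in> E \<longrightarrow> c a b \<noteq> 0"
    and rel: "\<And>a b d. {a, b} \<in> E \<Longrightarrow> {a, d} \<in> E \<Longrightarrow>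
      w (\<sigma> a) (\<sigma> b) (\<sigma> d) * (c a b * c b a) = v a b d * (c a d * c d a)"
  shows "transport \<sigma> c ` zigzag_ideal V E v \<subseteq> zigzag_ideal V E w"
proof -
  let ?P = "path_algebra V E :: ('k, 'v list \<Rightarrow>\<^sub>0 'k) graded_algebra"
  let ?I = "zigzag_ideal V E w"
  have V: "finite V" using G by (simp add: simple_graph_def)
  interpret P: ring ?P by (rule ring_path_algebra[OF V])
  interpret I: graded_algebra_ideal ?I ?P by (rule zigzag_ideal[OF G])
  have "transport \<sigma> c \<in> ring_hom ?P ?P"
    using transport_iso[OF G \<sigma> c] by (simp add: graded_alg_iso_def ring_iso_def)
  then interpret hom: ring_hom_ring ?P ?P "transport \<sigma> c"
    by (intro ring_hom_ringI2 P.ring_axioms)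
  have "ideal {f \<in> carrier ?P. transport \<sigma> c f \<in> ?I} ?P"
    by (rule hom.ideal_vimage[OF I.ideal_axioms])
  moreover have "transport \<sigma> c f \<in> ?I" if "f \<in> zigzag_relations V E v" for f
    using that[unfolded zigzag_relations_def]
  proof (elim UnE CollectE exE conjE)
    fix a1 a2 a3 assume f: "f = Poly_Mapping.single [a1, a2, a3] 1"
      and p: "[a1, a2, a3] \<in> paths V E" "a1 \<noteq> a3"
    have "[\<sigma> a1, \<sigma> a2, \<sigma> a3] \<in> paths V E"
      using map_path_in_paths[OF G \<sigma> p(1)] by simp
    moreover have "inj \<sigma>" using \<sigma> permutes_inj[of \<sigma> V] by (simp add: graph_aut_def)
    ultimately have "Poly_Mapping.single [\<sigma> a1, \<sigma> a2, \<sigma> a3] 1 \<in> zigzag_relations V E w"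
      unfolding zigzag_relations_def using p(2) inj_eq[of \<sigma> a1 a3] by blast
    then have "scale (c a1 a2 * c a2 a3) (Poly_Mapping.single [\<sigma> a1, \<sigma> a2, \<sigma> a3] 1) \<in> ?I"
      using I.I_smult_closed[OF subsetD[OF zigzag_relations_subset_ideal]]
      by (simp only: path_algebra_simps)
    then show "transport \<sigma> c f \<in> ?I" by (simp add: f)
  next
    fix a1 a2 a3 assume f: "f = Poly_Mapping.single [a1, a2, a1] 1 -
        Poly_Mapping.single [a1, a3, a1] (v a1 a2 a3)" and e: "{a1, a2} \<in> E" "{a1, a3} \<in> E"
    let ?r = "Poly_Mapping.single [\<sigma> a1, \<sigma> a2, \<sigma> a1] 1 -
        Poly_Mapping.single [\<sigma> a1, \<sigma> a3, \<sigma> a1] (w (\<sigma> a1) (\<sigma> a2) (\<sigma> a3))"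
    have "?r \<in> zigzag_relations V E w"
      unfolding zigzag_relations_def using e graph_aut_edge_iff[OF G \<sigma>] by blast
    then have "scale (c a1 a2 * c a2 a1) ?r \<in> ?I"
      using I.I_smult_closed[OF subsetD[OF zigzag_relations_subset_ideal]]
      by (simp only: path_algebra_simps)
    also have "scale (c a1 a2 * c a2 a1) ?r = transport \<sigma> c f"
      using rel[OF e] by (simp add: f transport_diff scale_diff ac_simps)
    finally show "transport \<sigma> c f \<in> ?I" .
  qed
  ultimately have "zigzag_ideal V E v \<subseteq> {f \<in> carrier ?P. transport \<sigma> c f \<in> ?I}"
    using zigzag_relations_carrier[OF G, of v] by (intro P.genideal_minimal) auto
  then show ?thesis by blast
qed

text \<open>A square root of the symmetric function \<open>d\<close> splits it evenly over the two arcs of each edge.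
  The transport maps for \<open>\<sigma>\<close> and for its inverse map the two ideals into each other, so the first
  maps one ideal onto the other.\<close>

lemma iso_if_szc_equiv:
  fixes v w :: "'v \<Rightarrow> 'v \<Rightarrow> 'v \<Rightarrow> 'k::field"
  assumes sqrts: "\<forall>x::'k. \<exists>y. y ^ 2 = x" and G: "simple_graph V E" and "szc_equiv V E v w"
  shows "graded_alg_iso (quot_algebra (path_algebra V E) (zigzag_ideal V E v))
    (quot_algebra (path_algebra V E) (zigzag_ideal V E w)) \<noteq> {}"
proof -
  obtain \<sigma> where \<sigma>: "\<sigma> \<in> carrier (graph_aut V E)" and "szc_twist E \<sigma> v w"
    using assms(3) by (auto simp: szc_equiv_def)
  from this(2) obtain d where d: "\<And>a b. {a, b} \<in> E \<Longrightarrow> d a b \<noteq> 0"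
    "\<And>a b. {a, b} \<in> E \<Longrightarrow> d a b = d b a"
    "\<And>a b c. {a, b} \<in> E \<Longrightarrow> {a, c} \<in> E \<Longrightarrow>
      w (\<sigma> a) (\<sigma> b) (\<sigma> c) * d a b = v a b c * d a c"
    by (rule szc_twistE) blast
  define c where "c a b = (SOME y. y ^ 2 = d a b)" for a b
  have c_sq: "c a b ^ 2 = d a b" for a b
    unfolding c_def using sqrts[rule_format, of "d a b"] by (rule someI_ex)
  have cc: "c a b * c b a = d a b" if "{a, b} \<in> E" for a b
  proof -
    have "c b a = c a b" using d(2)[OF that] by (simp add: c_def)
    then show ?thesis using c_sq[of a b] by (simp add: power2_eq_square)
  qed
  have "c a b \<noteq> 0" if "{a, b} \<in> E" for a b
    using d(1)[OF that] cc[OF that] by auto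
  then have c: "\<forall>a b. {a, b} \<in> E \<longrightarrow> c a b \<noteq> 0" by blast
  let ?\<tau> = "inv_into UNIV \<sigma>"
  let ?c = "\<lambda>a b. inverse (c (?\<tau> a) (?\<tau> b))"
  have \<tau>: "?\<tau> \<in> carrier (graph_aut V E)" by (rule graph_aut_inv[OF G \<sigma>])
  have \<tau>E: "{?\<tau> a, ?\<tau> b} \<in> E \<longleftrightarrow> {a, b} \<in> E" for a b
    by (rule graph_aut_edge_iff[OF G \<tau>])
  have inv: "\<sigma> (?\<tau> a) = a" for a
    using \<sigma> permutes_inverses(1)[of \<sigma> V a] by (simp add: graph_aut_def)
  let ?I = "zigzag_ideal V E v" and ?J = "zigzag_ideal V E w"
  have sub: "transport \<sigma> c ` ?I \<subseteq> ?J"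
    by (rule transport_zigzag_ideal[OF G \<sigma> c]) (simp_all add: cc d(3))
  have "transport ?\<tau> ?c ` ?J \<subseteq> ?I"
  proof (rule transport_zigzag_ideal[OF G \<tau>])
    show "\<forall>a b. {a, b} \<in> E \<longrightarrow> ?c a b \<noteq> 0"
      using c \<tau>E by auto
    fix a b e assume "{a, b} \<in> E" "{a, e} \<in> E"
    then have E: "{?\<tau> a, ?\<tau> b} \<in> E" "{?\<tau> a, ?\<tau> e} \<in> E" by (simp_all add: \<tau>E)
    have "?c a b * ?c b a = inverse (d (?\<tau> a) (?\<tau> b))" "?c a e * ?c e a = inverse (d (?\<tau> a) (?\<tau> e))"
      by (simp_all add: cc[OF E(1)] cc[OF E(2)] flip: inverse_mult_distrib)
    then show "v (?\<tau> a) (?\<tau> b) (?\<tau> e) * (?c a b * ?c b a) = w a b e * (?c a e * ?c e a)"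
      using d(3)[OF E] d(1)[OF E(1)] d(1)[OF E(2)] by (simp add: inv field_simps)
  qed
  moreover have "f = transport \<sigma> c (transport ?\<tau> ?c f)" if "f \<in> ?J" for f
  proof -
    interpret J: graded_algebra_ideal ?J "path_algebra V E" by (rule zigzag_ideal[OF G])
    have "Poly_Mapping.keys f \<subseteq> paths V E"
      using J.a_Hcarr[OF that] by (simp add: path_algebra_simps)
    then show ?thesis by (rule transport_transport(2)[OF G \<sigma> c, symmetric])
  qed
  ultimately have "?J \<subseteq> transport \<sigma> c ` ?I"
    by (intro subsetI rev_image_eqI) blast+
  with sub have img: "transport \<sigma> c ` ?I = ?J" by blast
  have "(\<lambda>X. transport \<sigma> c ` X) \<in> graded_alg_iso (quot_algebra (path_algebra V E) ?I)
      (quot_algebra (path_algebra V E) ?J)"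
    by (rule graded_alg_iso_quot[OF zigzag_ideal[OF G] zigzag_ideal[OF G] transport_iso[OF G \<sigma> c] img])
      (auto simp: path_algebra_simps)
  then show ?thesis by blast
qed

section \<open>Graph automorphisms from isomorphisms\<close>

text \<open>In a skew-zigzag algebra with weights \<open>x\<close>, the loop \<open>(a | b | a)\<close> is \<open>x a b\<close> times an element
  that depends on \<open>a\<close> only. This linear form reads off the coefficient of that element.\<close>

definition loop_form ::
  "'v set set \<Rightarrow> ('v \<Rightarrow> 'v \<Rightarrow> 'k::field) \<Rightarrow> 'v \<Rightarrow> ('v list \<Rightarrow>\<^sub>0 'k) \<Rightarrow> 'k" where
  "loop_form E x a f = (\<Sum>b | {a, b} \<in> E. x a b * Poly_Mapping.lookup f [a, b, a])"

definition vanishing_ideal ::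
  "'v set \<Rightarrow> 'v set set \<Rightarrow> ('v \<Rightarrow> 'v \<Rightarrow> 'k::field) \<Rightarrow> ('v list \<Rightarrow>\<^sub>0 'k) set" where
  "vanishing_ideal V E x = {f. Poly_Mapping.keys f \<subseteq> paths V E \<and>
    (\<forall>a. Poly_Mapping.lookup f [a] = 0) \<and> (\<forall>a b. Poly_Mapping.lookup f [a, b] = 0) \<and>
    (\<forall>a. loop_form E x a f = 0)}"

lemma loop_form_add: "loop_form E x a (f + g) = loop_form E x a f + loop_form E x a g"
  by (simp add: loop_form_def lookup_add distrib_left sum.distrib)

lemma loop_form_diff: "loop_form E x a (f - g) = loop_form E x a f - loop_form E x a g"
  by (simp add: loop_form_def lookup_minus right_diff_distrib sum_subtractf)

lemma loop_form_scale: "loop_form E x a (scale c f) = c * loop_form E x a f"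
  by (simp add: loop_form_def sum_distrib_left mult.left_commute)

lemma finite_neighbours: "simple_graph V E \<Longrightarrow> finite {b. {a, b} \<in> E}"
  by (rule finite_subset[of _ V]) (auto simp: simple_graph_def)

text \<open>Products of an element without terms of degree \<open>0\<close> and \<open>1\<close> with any element have in degree
  \<open>2\<close> only the products with the degree-\<open>0\<close> part of the other factor, which rescale the loop
  forms.\<close>

lemma vanishing_ideal:
  fixes x :: "'v \<Rightarrow> 'v \<Rightarrow> 'k::field"
  assumes V: "finite V"
  shows "ideal (vanishing_ideal V E x) (path_algebra V E)"
proof (rule idealI[OF ring_path_algebra[OF V]])
  show "subgroup (vanishing_ideal V E x) (add_monoid (path_algebra V E))"
  proof
    fix f assume f: "f \<in> vanishing_ideal V E x"
    have "inv\<^bsub>add_monoid (path_algebra V E)\<^esub> f = - f"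
      using path_algebra_a_inv[OF V, of f E] f
      by (simp add: a_inv_def vanishing_ideal_def path_algebra_simps(1))
    then show "inv\<^bsub>add_monoid (path_algebra V E)\<^esub> f \<in> vanishing_ideal V E x"
      using f loop_form_diff[of E x _ 0 f] by (simp add: vanishing_ideal_def loop_form_def)
  next
    fix f g assume "f \<in> vanishing_ideal V E x" "g \<in> vanishing_ideal V E x"
    then show "f \<otimes>\<^bsub>add_monoid (path_algebra V E)\<^esub> g \<in> vanishing_ideal V E x"
      using keys_add[of f g]
      by (auto simp: vanishing_ideal_def path_algebra_simps lookup_add loop_form_add)
  qed (auto simp: vanishing_ideal_def path_algebra_simps loop_form_def)
next
  fix f g :: "'v list \<Rightarrow>\<^sub>0 'k"
  assume f: "f \<in> vanishing_ideal V E x" and g: "g \<in> carrier (path_algebra V E)"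
  have k: "Poly_Mapping.keys f \<subseteq> paths V E" "Poly_Mapping.keys g \<subseteq> paths V E"
    using f g by (auto simp: vanishing_ideal_def path_algebra_simps)
  have f0: "Poly_Mapping.lookup f [a] = 0" "Poly_Mapping.lookup f [a, b] = 0" "loop_form E x a f = 0" for a b
    using f by (auto simp: vanishing_ideal_def)
  have "loop_form E x a (path_mult g f) = Poly_Mapping.lookup g [a] * loop_form E x a f" for a
    by (simp add: loop_form_def lookup_path_mult_short[OF k(2,1)] f0 sum_distrib_left mult.left_commute)
  then show "g \<otimes>\<^bsub>path_algebra V E\<^esub> f \<in> vanishing_ideal V E x"
    using keys_path_mult[OF k(2,1)]
    by (simp add: vanishing_ideal_def path_algebra_simps lookup_path_mult_short[OF k(2,1)] f0)
  have "loop_form E x a (path_mult f g) = Poly_Mapping.lookup g [a] * loop_form E x a f" for a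
    by (simp add: loop_form_def lookup_path_mult_short[OF k] f0 sum_distrib_left ac_simps)
  then show "f \<otimes>\<^bsub>path_algebra V E\<^esub> g \<in> vanishing_ideal V E x"
    using keys_path_mult[OF k]
    by (simp add: vanishing_ideal_def path_algebra_simps lookup_path_mult_short[OF k] f0)
qed

lemma zigzag_ideal_vanishing:
  fixes w :: "'v \<Rightarrow> 'v \<Rightarrow> 'v \<Rightarrow> 'k::field"
  assumes G: "simple_graph V E" and w: "w \<in> SZC E"
  shows "zigzag_ideal V E w \<subseteq> vanishing_ideal V E (szc_weight E w)"
proof -
  have V: "finite V" using G by (simp add: simple_graph_def)
  interpret ring "path_algebra V E :: ('k, 'v list \<Rightarrow>\<^sub>0 'k) graded_algebra"
    by (rule ring_path_algebra[OF V])
  have single: "loop_form E (szc_weight E w) z (Poly_Mapping.single [a, b, c] k) =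
      (if a = z \<and> c = z \<and> {a, b} \<in> E then szc_weight E w a b * k else 0)" for z a b c and k :: 'k
  proof (cases "a = z \<and> c = z")
    case True
    then have "loop_form E (szc_weight E w) z (Poly_Mapping.single [a, b, c] k) =
        (\<Sum>b' | {z, b'} \<in> E. if b = b' then szc_weight E w z b * k else 0)"
      unfolding loop_form_def by (intro sum.cong) (auto simp: lookup_single when_def)
    then show ?thesis using True finite_neighbours[OF G] by (simp add: sum.delta)
  next
    case False
    then show ?thesis unfolding loop_form_def by (auto simp: lookup_single when_def)
  qed
  have "f \<in> vanishing_ideal V E (szc_weight E w)" if f: "f \<in> zigzag_relations V E w" for f
  proof -
    have "Poly_Mapping.keys f \<subseteq> paths V E"
      using zigzag_relations_carrier[OF G] f by (auto simp: path_algebra_simps)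
    moreover have "(\<forall>a. Poly_Mapping.lookup f [a] = 0) \<and> (\<forall>a b. Poly_Mapping.lookup f [a, b] = 0)"
      using f by (auto simp: zigzag_relations_def lookup_minus lookup_single)
    moreover have "loop_form E (szc_weight E w) z f = 0" for z
      using f[unfolded zigzag_relations_def]
    proof (elim UnE CollectE exE conjE)
      fix a b c assume "f = Poly_Mapping.single [a, b, c] 1" "a \<noteq> c"
      then show ?thesis by (auto simp: single)
    next
      fix a b c assume f: "f = Poly_Mapping.single [a, b, a] 1 - Poly_Mapping.single [a, c, a] (w a b c)"
        and e: "{a, b} \<in> E" "{a, c} \<in> E"
      show ?thesis
        using e szc_eq_weight_ratio[OF w e] szc_weight_nonzero[OF w e(2)]
        by (cases "a = z") (simp_all add: f loop_form_diff single)
    qed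
    ultimately show ?thesis by (simp add: vanishing_ideal_def)
  qed
  then show ?thesis
    by (intro genideal_minimal vanishing_ideal[OF V]) blast
qed

lemma degree_0_lookup:
  assumes "f \<in> component (path_algebra V E) 0"
  shows "length p \<noteq> 1 \<Longrightarrow> Poly_Mapping.lookup f p = 0"
    and "(\<And>a. Poly_Mapping.lookup f [a] = 0) \<Longrightarrow> f = 0"
proof -
  have k: "p \<in> Poly_Mapping.keys f \<Longrightarrow> length p = 1" for p
    using assms by (cases p) (auto simp: path_algebra_simps paths_def path_length_def)
  then show 1: "length p \<noteq> 1 \<Longrightarrow> Poly_Mapping.lookup f p = 0" for p
    by (auto simp: in_keys_iff)
  assume 0: "\<And>a. Poly_Mapping.lookup f [a] = 0"
  show "f = 0"
  proof (rule poly_mapping_eqI)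
    show "Poly_Mapping.lookup f p = Poly_Mapping.lookup 0 p" for p
      using 0 1[of p] by (cases "length p = 1") (auto simp: length_Suc_conv)
  qed
qed

lemma degree_1_lookup:
  assumes "f \<in> component (path_algebra V E) 1"
  shows "length p \<noteq> 2 \<Longrightarrow> Poly_Mapping.lookup f p = 0"
    and "Poly_Mapping.lookup f [a, b] \<noteq> 0 \<Longrightarrow> {a, b} \<in> E"
    and "(\<And>a b. Poly_Mapping.lookup f [a, b] = 0) \<Longrightarrow> f = 0"
proof -
  have k: "length p = 2 \<and> p \<in> paths V E" if "p \<in> Poly_Mapping.keys f" for p
  proof -
    have "p \<in> paths V E" "length p - 1 = 1"
      using that assms by (auto simp: path_algebra_simps path_length_def)
    then show ?thesis by simp
  qed
  then show 1: "length p \<noteq> 2 \<Longrightarrow> Poly_Mapping.lookup f p = 0" for p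
    by (auto simp: in_keys_iff)
  show "Poly_Mapping.lookup f [a, b] \<noteq> 0 \<Longrightarrow> {a, b} \<in> E"
    using k[of "[a, b]"] by (auto simp: in_keys_iff paths_def arcs_iff)
  assume 0: "\<And>a b. Poly_Mapping.lookup f [a, b] = 0"
  show "f = 0"
  proof (rule poly_mapping_eqI)
    show "Poly_Mapping.lookup f p = Poly_Mapping.lookup 0 p" for p
      using 0 1[of p] by (cases "length p = 2") (auto simp: length_Suc_conv numeral_2_eq_2)
  qed
qed

text \<open>An isomorphism of the quotients, seen on representatives: \<open>R f f'\<close> means that the coset of
  \<open>f\<close> is mapped to the coset of \<open>f'\<close>. Working with this relation avoids choosing a
  linear lift of the isomorphism.\<close>

locale lifted_iso =
  fixes V :: "'v set" and E :: "'v set set" and v w :: "'v \<Rightarrow> 'v \<Rightarrow> 'v \<Rightarrow> 'k::field"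
    and R :: "('v list \<Rightarrow>\<^sub>0 'k) \<Rightarrow> ('v list \<Rightarrow>\<^sub>0 'k) \<Rightarrow> bool"
  assumes G: "simple_graph V E" and v: "v \<in> SZC E" and w: "w \<in> SZC E"
    and R_mult: "\<lbrakk>R f f'; R g g'\<rbrakk> \<Longrightarrow> R (path_mult f g) (path_mult f' g')"
    and R_scale: "R f f' \<Longrightarrow> R (scale c f) (scale c f')"
    and R_cong: "\<lbrakk>R f f'; f - g \<in> zigzag_ideal V E v; Poly_Mapping.keys g \<subseteq> paths V E\<rbrakk> \<Longrightarrow> R g f'"
    and R_unique: "\<lbrakk>R f f'; R f f''\<rbrakk> \<Longrightarrow> f' - f'' \<in> zigzag_ideal V E w"
    and R_inj: "\<lbrakk>R f f'; R g f'\<rbrakk> \<Longrightarrow> f - g \<in> zigzag_ideal V E v"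
    and R_component: "f \<in> component (path_algebra V E) n \<Longrightarrow>
      \<exists>f'\<in>component (path_algebra V E) n. R f f'"
begin

text \<open>The coefficients in degrees \<open>0\<close> and \<open>1\<close> and the loop forms are invariants of cosets; all
  further information about the isomorphism is extracted through them.\<close>

lemma R_lookup:
  assumes "R f f'" "R f f''"
  shows "Poly_Mapping.lookup f' [a] = Poly_Mapping.lookup f'' [a]"
    "Poly_Mapping.lookup f' [a, b] = Poly_Mapping.lookup f'' [a, b]"
    "loop_form E (szc_weight E w) a f' = loop_form E (szc_weight E w) a f''"
proof -
  have "f' - f'' \<in> vanishing_ideal V E (szc_weight E w)"
    using R_unique[OF assms] zigzag_ideal_vanishing[OF G w] by blast
  then have *: "Poly_Mapping.lookup (f' - f'') [a] = 0" "Poly_Mapping.lookup (f' - f'') [a, b] = 0"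
      "loop_form E (szc_weight E w) a (f' - f'') = 0"
    by (simp_all add: vanishing_ideal_def)
  from * show "Poly_Mapping.lookup f' [a] = Poly_Mapping.lookup f'' [a]"
    "Poly_Mapping.lookup f' [a, b] = Poly_Mapping.lookup f'' [a, b]"
    "loop_form E (szc_weight E w) a f' = loop_form E (szc_weight E w) a f''"
    by (simp_all add: lookup_minus loop_form_diff)
qed

lemma R_0: "R 0 0"
proof -
  have "(0 :: 'v list \<Rightarrow>\<^sub>0 'k) \<in> component (path_algebra V E) 0" by (simp add: path_algebra_simps)
  then obtain f where "R 0 f" using R_component by blast
  then have "R (scale 0 0) (scale 0 f)" by (rule R_scale)
  moreover have "scale 0 g = 0" for g :: "'v list \<Rightarrow>\<^sub>0 'k"
    by (rule poly_mapping_eqI) simp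
  ultimately show ?thesis by simp
qed

lemma R_zero_lookup:
  assumes "R f 0"
  shows "Poly_Mapping.lookup f [a] = 0" "Poly_Mapping.lookup f [a, b] = 0"
  using R_inj[OF assms R_0] zigzag_ideal_vanishing[OF G v] by (auto simp: vanishing_ideal_def)

definition image_vertex :: "'v \<Rightarrow> 'v list \<Rightarrow>\<^sub>0 'k" where
  "image_vertex a = (SOME f. f \<in> component (path_algebra V E) 0 \<and> R (Poly_Mapping.single [a] 1) f)"

definition image_arc :: "'v \<Rightarrow> 'v \<Rightarrow> 'v list \<Rightarrow>\<^sub>0 'k" where
  "image_arc a b = (SOME f. f \<in> component (path_algebra V E) 1 \<and> R (Poly_Mapping.single [a, b] 1) f)"

abbreviation vcoeff :: "'v \<Rightarrow> 'v \<Rightarrow> 'k" where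
  "vcoeff a b \<equiv> Poly_Mapping.lookup (image_vertex a) [b]"

lemma image_vertex:
  assumes "a \<in> V"
  shows "image_vertex a \<in> component (path_algebra V E) 0"
    and "R (Poly_Mapping.single [a] 1) (image_vertex a)"
proof -
  have "Poly_Mapping.single [a] (1::'k) \<in> component (path_algebra V E) 0"
    using assms by (simp add: path_algebra_simps paths_def path_length_def)
  then have "\<exists>f. f \<in> component (path_algebra V E) 0 \<and> R (Poly_Mapping.single [a] 1) f"
    using R_component by blast
  from someI_ex[OF this] show "image_vertex a \<in> component (path_algebra V E) 0"
    and "R (Poly_Mapping.single [a] 1) (image_vertex a)"
    by (simp_all add: image_vertex_def)
qed

lemma edge_in_V: "{a, b} \<in> E \<Longrightarrow> a \<in> V" "{a, b} \<in> E \<Longrightarrow> b \<in> V"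
  using edge_endpoints[OF G] by blast+

lemma image_arc:
  assumes "{a, b} \<in> E"
  shows "image_arc a b \<in> component (path_algebra V E) 1"
    and "R (Poly_Mapping.single [a, b] 1) (image_arc a b)"
proof -
  have "Poly_Mapping.single [a, b] (1::'k) \<in> component (path_algebra V E) 1"
    using assms edge_in_V by (simp add: path_algebra_simps paths_def path_length_def arcs_iff)
  then have "\<exists>f. f \<in> component (path_algebra V E) 1 \<and> R (Poly_Mapping.single [a, b] 1) f"
    using R_component by blast
  from someI_ex[OF this] show "image_arc a b \<in> component (path_algebra V E) 1"
    and "R (Poly_Mapping.single [a, b] 1) (image_arc a b)"
    by (simp_all add: image_arc_def)
qed

lemma component_keys: "f \<in> component (path_algebra V E) n \<Longrightarrow> Poly_Mapping.keys f \<subseteq> paths V E"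
  by (auto simp: path_algebra_simps)

text \<open>The trivial paths are orthogonal idempotents, hence so are their images, and an orthogonal
  family in a product of copies of the field has disjoint supports.\<close>

lemma vcoeff_mult:
  assumes "a \<in> V" "a' \<in> V"
  shows "vcoeff a b * vcoeff a' b = (if a = a' then vcoeff a b else 0)"
proof -
  let ?s = "\<lambda>a. Poly_Mapping.single [a] (1::'k)"
  have m: "R (path_mult (?s a) (?s a')) (path_mult (image_vertex a) (image_vertex a'))"
    by (intro R_mult image_vertex assms)
  have "path_mult (?s a) (?s a') = (if a = a' then ?s a else 0)"
    by (simp add: path_mult_single path_term_def)
  then have "R (path_mult (?s a) (?s a')) (if a = a' then image_vertex a else 0)"
    using image_vertex(2)[OF assms(1)] R_0 by (cases "a = a'") simp_all
  from R_lookup(1)[OF m this, of b] show ?thesis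
    by (simp add: lookup_path_mult_short[OF component_keys component_keys,
          OF image_vertex(1) image_vertex(1), OF assms] split: if_splits)
qed

lemma vcoeff_exists:
  assumes "a \<in> V"
  shows "\<exists>b\<in>V. vcoeff a b \<noteq> 0"
proof (rule ccontr)
  assume no: "\<not> (\<exists>b\<in>V. vcoeff a b \<noteq> 0)"
  have "vcoeff a b = 0" for b
  proof (cases "b \<in> V")
    case False
    then have "[b] \<notin> Poly_Mapping.keys (image_vertex a)"
      using component_keys[OF image_vertex(1)[OF assms]] by (auto simp: paths_def)
    then show ?thesis by (simp add: in_keys_iff)
  qed (use no in blast)
  then have "image_vertex a = 0"
    by (rule degree_0_lookup(2)[OF image_vertex(1)[OF assms]])
  then show False
    using R_zero_lookup(1)[of "Poly_Mapping.single [a] 1" a] image_vertex(2)[OF assms] by simp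
qed

definition vperm :: "'v \<Rightarrow> 'v" where
  "vperm a = (if a \<in> V then SOME b. b \<in> V \<and> vcoeff a b \<noteq> 0 else a)"

lemma vperm:
  assumes "a \<in> V"
  shows "vperm a \<in> V" "vcoeff a (vperm a) \<noteq> 0"
  using someI_ex[of "\<lambda>b. b \<in> V \<and> vcoeff a b \<noteq> 0"] vcoeff_exists[OF assms] assms
  by (auto simp: vperm_def)

lemma vperm_permutes: "vperm permutes V"
proof (rule bij_imp_permutes)
  have "inj_on vperm V"
  proof (rule inj_onI)
    fix a a' assume "a \<in> V" "a' \<in> V" "vperm a = vperm a'"
    then show "a = a'"
      using vcoeff_mult[of a a' "vperm a"] vperm[of a] vperm[of a'] by (auto split: if_splits)
  qed
  moreover have "vperm ` V \<subseteq> V" using vperm by blast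
  moreover have "finite V" using G by (simp add: simple_graph_def)
  ultimately show "bij_betw vperm V V"
    by (simp add: bij_betw_def endo_inj_surj)
qed (simp add: vperm_def)

lemma vcoeff_eq:
  assumes "a \<in> V" "b \<in> V"
  shows "vcoeff a b = (if b = vperm a then 1 else 0)"
proof (cases "b = vperm a")
  case True
  then show ?thesis using vcoeff_mult[OF assms(1,1), of b] vperm(2)[OF assms(1)] by simp
next
  case False
  obtain a' where a': "a' \<in> V" "b = vperm a'"
    using permutes_image[OF vperm_permutes] assms(2) by blast
  with False have "a \<noteq> a'" by blast
  then show ?thesis
    using False vcoeff_mult[OF assms(1) a'(1), of b] vperm(2)[OF a'(1)] a'(2) by simp
qed

abbreviation acoeff :: "'v \<Rightarrow> 'v \<Rightarrow> 'k" where
  "acoeff a b \<equiv> Poly_Mapping.lookup (image_arc a b) [vperm a, vperm b]"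

text \<open>The arc \<open>(a | b)\<close> is fixed by multiplication with \<open>(a)\<close> from the left and \<open>(b)\<close> from the
  right, so its image is fixed by the corresponding trivial paths.\<close>

lemma image_arc_lookup:
  assumes e: "{a, b} \<in> E" and nz: "Poly_Mapping.lookup (image_arc a b) [c, d] \<noteq> 0"
  shows "c = vperm a \<and> d = vperm b"
proof -
  note V = edge_in_V[OF e]
  let ?s = "Poly_Mapping.single [a, b] (1::'k)"
  have cd: "c \<in> V" "d \<in> V"
    using degree_1_lookup(2)[OF image_arc(1)[OF e] nz] edge_in_V by blast+
  have left: "R ?s (path_mult (image_vertex a) (image_arc a b))"
    using R_mult[OF image_vertex(2)[OF V(1)] image_arc(2)[OF e]]
    by (simp add: path_mult_single path_term_def)
  have right: "R ?s (path_mult (image_arc a b) (image_vertex b))"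
    using R_mult[OF image_arc(2)[OF e] image_vertex(2)[OF V(2)]]
    by (simp add: path_mult_single path_term_def)
  have len: "Poly_Mapping.lookup (image_vertex a) [c, d] = 0" "Poly_Mapping.lookup (image_vertex b) [c, d] = 0"
    using degree_0_lookup(1)[OF image_vertex(1)[OF V(1)], of "[c, d]"]
      degree_0_lookup(1)[OF image_vertex(1)[OF V(2)], of "[c, d]"] by simp_all
  have "vcoeff a c * Poly_Mapping.lookup (image_arc a b) [c, d] = Poly_Mapping.lookup (image_arc a b) [c, d]"
    using R_lookup(2)[OF left image_arc(2)[OF e], of c d] len
    by (simp add: lookup_path_mult_short[OF component_keys component_keys,
          OF image_vertex(1)[OF V(1)] image_arc(1)[OF e]])
  moreover have "Poly_Mapping.lookup (image_arc a b) [c, d] * vcoeff b d = Poly_Mapping.lookup (image_arc a b) [c, d]"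
    using R_lookup(2)[OF right image_arc(2)[OF e], of c d] len
    by (simp add: lookup_path_mult_short[OF component_keys component_keys,
          OF image_arc(1)[OF e] image_vertex(1)[OF V(2)]])
  ultimately have "vcoeff a c \<noteq> 0" "vcoeff b d \<noteq> 0" using nz by auto
  then show ?thesis using vcoeff_eq V cd by (metis (full_types))
qed

lemma acoeff_nonzero:
  assumes "{a, b} \<in> E"
  shows "acoeff a b \<noteq> 0"
proof
  assume "acoeff a b = 0"
  then have "Poly_Mapping.lookup (image_arc a b) [c, d] = 0" for c d
    using image_arc_lookup[OF assms, of c d] by auto
  then have "image_arc a b = 0"
    by (rule degree_1_lookup(3)[OF image_arc(1)[OF assms]])
  then show False
    using R_zero_lookup(2)[of "Poly_Mapping.single [a, b] 1" a b] image_arc(2)[OF assms] by simp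
qed

text \<open>Edges go to edges because the images of arcs are nonzero. Non-edges go to non-edges by
  counting: an injective map of the finite set of edges into itself is onto.\<close>

lemma vperm_aut: "vperm \<in> carrier (graph_aut V E)"
proof -
  have inj: "inj vperm" by (rule permutes_inj[OF vperm_permutes])
  have edge: "{vperm a, vperm b} \<in> E" if "{a, b} \<in> E" for a b
    by (rule degree_1_lookup(2)[OF image_arc(1)[OF that] acoeff_nonzero[OF that]])
  have "(\<lambda>e. vperm ` e) ` E \<subseteq> E"
  proof
    fix x assume "x \<in> (\<lambda>e. vperm ` e) ` E"
    then obtain e where "e \<in> E" "x = vperm ` e" by blast
    moreover from this(1) obtain a b where "e = {a, b}"
      using G by (auto simp: simple_graph_def card_2_iff)
    ultimately show "x \<in> E" using edge by simp
  qed
  moreover have "finite E"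
    using G finite_subset[of E "Pow V"] by (auto simp: simple_graph_def)
  moreover have "inj_on (\<lambda>e. vperm ` e) E"
    by (rule inj_onI) (simp add: inj_image_eq_iff[OF inj])
  ultimately have img: "(\<lambda>e. vperm ` e) ` E = E" by (simp add: endo_inj_surj)
  have "{a, b} \<in> E" if "{vperm a, vperm b} \<in> E" for a b
  proof -
    have "vperm ` {a, b} \<in> (\<lambda>e. vperm ` e) ` E" using that by (simp add: img)
    then obtain e where "e \<in> E" "vperm ` {a, b} = vperm ` e" by (elim imageE)
    then show ?thesis by (simp only: inj_image_eq_iff[OF inj])
  qed
  then have "{vperm a, vperm b} \<in> E \<longleftrightarrow> {a, b} \<in> E" for a b
    using edge[of a b] by blast
  then show ?thesis using vperm_permutes by (simp add: graph_aut_def)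
qed

lemma loop_form_image:
  assumes e: "{a, b} \<in> E"
  shows "loop_form E (szc_weight E w) (vperm a) (path_mult (image_arc a b) (image_arc b a)) =
    szc_weight E w (vperm a) (vperm b) * (acoeff a b * acoeff b a)"
proof -
  have e': "{b, a} \<in> E" using e by (simp add: insert_commute)
  note c = image_arc(1)[OF e] image_arc(1)[OF e']
  have "Poly_Mapping.lookup (path_mult (image_arc a b) (image_arc b a)) [vperm a, z, vperm a] =
      (if z = vperm b then acoeff a b * acoeff b a else 0)" for z
    using degree_1_lookup(1)[OF c(1), of "[vperm a]"] degree_1_lookup(1)[OF c(2), of "[vperm a]"]
      image_arc_lookup[OF e, of "vperm a" z]
    by (auto simp: lookup_path_mult_short[OF component_keys component_keys, OF c])
  moreover have "{vperm a, vperm b} \<in> E"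
    using e graph_aut_edge_iff[OF G vperm_aut] by blast
  ultimately show ?thesis
    using finite_neighbours[OF G, of "vperm a"]
    by (simp add: loop_form_def if_distrib[of "\<lambda>x. _ * x"] sum.delta cong: if_cong)
qed

text \<open>The relation between the loops \<open>(a | b | a)\<close> and \<open>(a | c | a)\<close> in the source, evaluated by the
  loop form of the target at the image of \<open>a\<close>.\<close>

lemma vperm_twist: "szc_twist E vperm v w"
proof (rule szc_twistI[where d = "\<lambda>a b. acoeff a b * acoeff b a"])
  fix a b assume "{a, b} \<in> E"
  then show "acoeff a b * acoeff b a \<noteq> 0"
    using acoeff_nonzero[of a b] acoeff_nonzero[of b a] by (simp add: insert_commute)
next
  fix a b c assume e: "{a, b} \<in> E" "{a, c} \<in> E"
  then have e': "{b, a} \<in> E" "{c, a} \<in> E" by (simp_all add: insert_commute)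
  let ?m = "\<lambda>b. path_mult (image_arc a b) (image_arc b a)"
  let ?s = "\<lambda>b. Poly_Mapping.single [a, b, a] (1::'k)"
  have s: "R (?s b) (?m b)" if "{a, b} \<in> E" "{b, a} \<in> E" for b
    using R_mult[OF image_arc(2)[OF that(1)] image_arc(2)[OF that(2)]]
    by (simp add: path_mult_single path_term_def)
  have keys: "Poly_Mapping.keys (?s b) \<subseteq> paths V E"
    using e(1) e' edge_in_V by (simp add: paths_def arcs_iff)
  have "?s b - scale (v a b c) (?s c) \<in> zigzag_relations V E v"
    unfolding zigzag_relations_def using e by auto
  then have "?s b - scale (v a b c) (?s c) \<in> zigzag_ideal V E v"
    using zigzag_relations_subset_ideal by blast
  moreover have "Poly_Mapping.keys (scale (v a b c) (?s c)) \<subseteq> paths V E"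
    using keys_scale[of "v a b c" "?s c"] e(2) e' edge_in_V by (auto simp: paths_def arcs_iff)
  ultimately have 1: "R (scale (v a b c) (?s c)) (?m b)"
    by (rule R_cong[OF s[OF e(1) e'(1)]])
  have 2: "R (scale (v a b c) (?s c)) (scale (v a b c) (?m c))"
    by (rule R_scale[OF s[OF e(2) e'(2)]])
  have "loop_form E (szc_weight E w) (vperm a) (?m b) =
      v a b c * loop_form E (szc_weight E w) (vperm a) (?m c)"
    using R_lookup(3)[OF 1 2] by (simp only: loop_form_scale)
  then have eq: "szc_weight E w (vperm a) (vperm b) * (acoeff a b * acoeff b a) =
      v a b c * (szc_weight E w (vperm a) (vperm c) * (acoeff a c * acoeff c a))"
    by (simp add: loop_form_image[OF e(1)] loop_form_image[OF e(2)])
  have E: "{vperm a, vperm b} \<in> E" "{vperm a, vperm c} \<in> E"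
    using e graph_aut_edge_iff[OF G vperm_aut] by blast+
  show "w (vperm a) (vperm b) (vperm c) * (acoeff a b * acoeff b a) = v a b c * (acoeff a c * acoeff c a)"
  proof -
    let ?x = "szc_weight E w (vperm a) (vperm c)"
    have nz: "?x \<noteq> 0" by (rule szc_weight_nonzero[OF w E(2)])
    have "?x * (w (vperm a) (vperm b) (vperm c) * (acoeff a b * acoeff b a)) =
        szc_weight E w (vperm a) (vperm b) * (acoeff a b * acoeff b a)"
      by (simp add: szc_eq_weight_ratio[OF w E] nz)
    also have "\<dots> = ?x * (v a b c * (acoeff a c * acoeff c a))"
      unfolding eq by (rule mult.left_commute)
    finally show ?thesis using mult_left_cancel[OF nz] by blast
  qed
qed (simp add: mult.commute)

lemma szc_equiv_of_lift: "szc_equiv V E v w"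
  unfolding szc_equiv_def using vperm_aut vperm_twist by blast

end

lemma szc_equiv_if_iso:
  fixes v w :: "'v \<Rightarrow> 'v \<Rightarrow> 'v \<Rightarrow> 'k::field"
  assumes G: "simple_graph V E" and v: "v \<in> SZC E" and w: "w \<in> SZC E"
    and h: "h \<in> graded_alg_iso (quot_algebra (path_algebra V E) (zigzag_ideal V E v))
      (quot_algebra (path_algebra V E) (zigzag_ideal V E w))"
  shows "szc_equiv V E v w"
proof -
  let ?P = "path_algebra V E :: ('k, 'v list \<Rightarrow>\<^sub>0 'k) graded_algebra"
  let ?I = "zigzag_ideal V E v" and ?J = "zigzag_ideal V E w"
  have V: "finite V" using G by (simp add: simple_graph_def)
  interpret I: graded_algebra_ideal ?I ?P by (rule zigzag_ideal[OF G])
  interpret J: graded_algebra_ideal ?J ?P by (rule zigzag_ideal[OF G])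
  let ?A = "quot_algebra ?P ?I" and ?B = "quot_algebra ?P ?J"
  have iso: "h \<in> ring_iso ?A ?B" and smult: "\<And>c X. X \<in> carrier ?A \<Longrightarrow> h (c \<odot>\<^bsub>?A\<^esub> X) = c \<odot>\<^bsub>?B\<^esub> h X"
    and deg: "\<And>n. h ` component ?A n = component ?B n"
    using h by (auto simp: graded_alg_iso_def)
  note hom = ring_iso_memE[OF iso]
  have inj: "inj_on h (carrier ?A)" using hom(5) by (simp add: bij_betw_def)
  define R where "R f f' \<longleftrightarrow> f \<in> carrier ?P \<and> f' \<in> carrier ?P \<and>
      h (?I +>\<^bsub>?P\<^esub> f) = ?J +>\<^bsub>?P\<^esub> f'" for f f'
  have cosA: "?I +>\<^bsub>?P\<^esub> f \<in> carrier ?A" if "f \<in> carrier ?P" for f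
    using that by (simp add: I.quot_algebra_simps)
  have minus: "f \<ominus>\<^bsub>?P\<^esub> g = f - g" if "f \<in> carrier ?P" "g \<in> carrier ?P" for f g
    using path_algebra_a_minus[OF V that(2)] .
  have scale_R: "R (scale c f) (scale c f')" if "R f f'" for c f f'
  proof -
    have f: "f \<in> carrier ?P" "f' \<in> carrier ?P" "h (?I +>\<^bsub>?P\<^esub> f) = ?J +>\<^bsub>?P\<^esub> f'"
      using that by (simp_all add: R_def)
    have "h (?I +>\<^bsub>?P\<^esub> (c \<odot>\<^bsub>?P\<^esub> f)) = ?J +>\<^bsub>?P\<^esub> (c \<odot>\<^bsub>?P\<^esub> f')"
      using smult[OF cosA[OF f(1)], of c] f by (simp add: I.quot_algebra_smult J.quot_algebra_smult)
    then show ?thesis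
      using I.smult_closed[OF f(1), of c] I.smult_closed[OF f(2), of c]
      by (simp add: R_def path_algebra_simps(6))
  qed
  have comp_R: "\<exists>f'\<in>component ?P n. R f f'" if f: "f \<in> component ?P n" for f n
  proof -
    have sub: "component ?P n \<subseteq> carrier ?P" by (auto simp: path_algebra_simps)
    have "?I +>\<^bsub>?P\<^esub> f \<in> component ?A n" using f by (simp add: I.quot_algebra_simps)
    then have "h (?I +>\<^bsub>?P\<^esub> f) \<in> component ?B n" using deg by blast
    then show ?thesis using f sub by (auto simp: J.quot_algebra_simps R_def)
  qed
  interpret lifted_iso V E v w R
  proof (intro lifted_iso.intro G v w)
    fix f f' g g' assume "R f f'" "R g g'"
    then show "R (path_mult f g) (path_mult f' g')"
      using hom(2)[OF cosA cosA, of f g] I.m_closed[of f g] I.m_closed[of f' g']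
      by (simp add: R_def I.quot_algebra_mult J.quot_algebra_mult path_algebra_simps(2))
  next
    fix f f' c assume "R f f'"
    then show "R (scale c f) (scale c f')" by (rule scale_R)
  next
    fix f f' g assume *: "R f f'" "f - g \<in> ?I" "Poly_Mapping.keys g \<subseteq> paths V E"
    then have "f \<in> carrier ?P" "g \<in> carrier ?P" by (simp_all add: R_def path_algebra_simps(1))
    with * show "R g f'"
      using I.coset_eq_iff[of f g] minus[of f g] by (simp add: R_def)
  next
    fix f f' f'' assume *: "R f f'" "R f f''"
    then have "f' \<in> carrier ?P" "f'' \<in> carrier ?P" "?J +>\<^bsub>?P\<^esub> f' = ?J +>\<^bsub>?P\<^esub> f''"
      by (simp_all add: R_def)
    then show "f' - f'' \<in> ?J" using J.coset_eq_iff[of f' f''] minus[of f' f''] by simp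
  next
    fix f f' g assume *: "R f f'" "R g f'"
    then have c: "f \<in> carrier ?P" "g \<in> carrier ?P" and "h (?I +>\<^bsub>?P\<^esub> f) = h (?I +>\<^bsub>?P\<^esub> g)"
      by (simp_all add: R_def)
    then have "?I +>\<^bsub>?P\<^esub> f = ?I +>\<^bsub>?P\<^esub> g" using inj_onD[OF inj] cosA by blast
    then show "f - g \<in> ?I" using I.coset_eq_iff[OF c] minus[OF c] by simp
  qed (rule comp_R)
  show ?thesis by (rule szc_equiv_of_lift)
qed

section \<open>The classification\<close>

lemma bij_betw_images_same_fibres:
  assumes "\<And>x y. x \<in> X \<Longrightarrow> y \<in> X \<Longrightarrow> f x = f y \<longleftrightarrow> g x = g y"
  shows "\<exists>F. bij_betw F (f ` X) (g ` X)"
proof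
  have inv: "inv_into X f (f x) \<in> X" "g (inv_into X f (f x)) = g x" if "x \<in> X" for x
    using that assms[of "inv_into X f (f x)" x] by (auto simp: f_inv_into_f inv_into_into)
  show "bij_betw (g \<circ> inv_into X f) (f ` X) (g ` X)"
    unfolding bij_betw_def using inv assms by (auto simp: inj_on_def image_iff)
qed

text \<open>The classes of \<open>p x\<close> and \<open>p y\<close> are equal exactly if \<open>q x = q y\<close>. That the relation is an
  equivalence is part of the assumption, as it is pulled back from equality.\<close>

lemma quotient_bij_of_fibres:
  assumes R: "\<And>x y. x \<in> X \<Longrightarrow> y \<in> X \<Longrightarrow> r (p x) (p y) \<longleftrightarrow> q x = q y"
  shows "\<exists>F. bij_betw F ((p ` X) // {(A, B). A \<in> p ` X \<and> B \<in> p ` X \<and> r A B}) (q ` X)"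
proof -
  let ?R = "{(A, B). A \<in> p ` X \<and> B \<in> p ` X \<and> r A B}"
  have cl: "?R `` {p x} = p ` {y \<in> X. q x = q y}" if "x \<in> X" for x
    using that R by auto
  have "(p ` X) // ?R = (\<lambda>x. ?R `` {p x}) ` X"
    by (auto simp: quotient_def)
  moreover have "?R `` {p x} = ?R `` {p y} \<longleftrightarrow> q x = q y" if "x \<in> X" "y \<in> X" for x y
  proof
    assume "?R `` {p x} = ?R `` {p y}"
    moreover have "p y \<in> ?R `` {p y}" using that R by auto
    ultimately have "r (p x) (p y)" by auto
    then show "q x = q y" using R that by blast
  next
    assume "q x = q y"
    then show "?R `` {p x} = ?R `` {p y}" by (simp only: cl that)
  qed
  ultimately show ?thesis
    using bij_betw_images_same_fibres[of X "\<lambda>x. ?R `` {p x}" q] by simp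
qed

text \<open>A vertex has at most one neighbour here, so all entries are of the form \<open>v a b b\<close>.\<close>

lemma SZC_singleton:
  fixes V :: "'v set"
  assumes G: "simple_graph V E" and card: "card V \<le> 2"
  shows "(SZC E :: ('v \<Rightarrow> 'v \<Rightarrow> 'v \<Rightarrow> 'k::field) set) =
    {\<lambda>a b c. if {a, b} \<in> E \<and> {a, c} \<in> E then 1 else undefined}"
proof -
  have V: "finite V" using G by (simp add: simple_graph_def)
  have bc: "b = c" if "{a, b} \<in> E" "{a, c} \<in> E" for a b c
  proof (rule ccontr)
    assume "b \<noteq> c"
    then have "card {a, b, c} = 3"
      using edge_endpoints(3)[OF G that(1)] edge_endpoints(3)[OF G that(2)] by simp
    moreover have "card {a, b, c} \<le> card V"
      using edge_endpoints(1,2)[OF G that(1)] edge_endpoints(2)[OF G that(2)] V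
      by (intro card_mono) auto
    ultimately show False using card by simp
  qed
  have "v a b c = (if {a, b} \<in> E \<and> {a, c} \<in> E then 1 else undefined)"
    if "v \<in> SZC E" for v :: "'v \<Rightarrow> 'v \<Rightarrow> 'v \<Rightarrow> 'k" and a b c
    using bc[of a b c] SZC_D(1)[OF that, of a b] SZC_D(4)[OF that, of a b c] by auto
  then have "SZC E \<subseteq> {(\<lambda>a b c. if {a, b} \<in> E \<and> {a, c} \<in> E then 1 else undefined)
      :: 'v \<Rightarrow> 'v \<Rightarrow> 'v \<Rightarrow> 'k}"
    by (auto simp: fun_eq_iff)
  moreover have "(\<lambda>a b c. if {a, b} \<in> E \<and> {a, c} \<in> E then 1 else undefined) \<in>
      (SZC E :: ('v \<Rightarrow> 'v \<Rightarrow> 'v \<Rightarrow> 'k) set)"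
    by (simp add: SZC_def)
  ultimately show ?thesis by blast
qed

theorem theorem4p12:
  fixes V :: "'v set" and E :: "'v set set"
  assumes sqrts: "\<forall>x::'k::field. \<exists>y. y ^ 2 = x"
    and graph: "connected_graph V E"
  shows "\<exists>F. bij_betw F
           (iso_classes (Sigma_algs V E :: ('v, 'k) zigzag set))
           (orbits (graph_aut V E)
              (H1 V E :: ((('v \<times> 'v) \<Rightarrow>\<^sub>0 int) set \<Rightarrow> 'k) set) (H1_act V E))"
proof -
  have G: "simple_graph V E" and ne: "V \<noteq> {}"
    using graph by (auto simp: connected_graph_def)
  let ?A = "skew_zigzag V E :: ('v \<Rightarrow> 'v \<Rightarrow> 'v \<Rightarrow> 'k) \<Rightarrow> ('v, 'k) zigzag"
  let ?O = "\<lambda>v. orbit (graph_aut V E) (H1_act V E) (szc_class V E (v :: 'v \<Rightarrow> 'v \<Rightarrow> 'v \<Rightarrow> 'k))"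
  show ?thesis
  proof (cases "card V \<le> 2")
    case True
    then obtain v :: "'v \<Rightarrow> 'v \<Rightarrow> 'v \<Rightarrow> 'k" where "SZC E = {v}" using SZC_singleton[OF G] by blast
    then have "\<exists>X. iso_classes (Sigma_algs V E :: ('v, 'k) zigzag set) = {X}"
      "orbits (graph_aut V E) (H1 V E :: (_ \<Rightarrow> 'k) set) (H1_act V E) = {?O v}"
      by (auto simp: iso_classes_def Sigma_algs_def quotient_def orbits_H1[OF graph])
    then show ?thesis by (auto simp: bij_betw_def intro!: exI[of _ "\<lambda>_. ?O v"])
  next
    case False
    have "zigzag_isomorphic (?A v) (?A w) \<longleftrightarrow> ?O v = ?O w" if "v \<in> SZC E" "w \<in> SZC E" for v w
    proof -
      have "zigzag_isomorphic (?A v) (?A w) \<longleftrightarrow> szc_equiv V E v w"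
        using False iso_if_szc_equiv[OF sqrts G] szc_equiv_if_iso[OF G that]
        by (auto simp: skew_zigzag_def)
      then show ?thesis by (simp add: orbit_szc_class_eq_iff[OF graph that])
    qed
    from quotient_bij_of_fibres[of "SZC E" zigzag_isomorphic ?A ?O, OF this] show ?thesis
      by (simp add: iso_classes_def Sigma_algs_def orbits_H1[OF graph])
  qed
qed

end
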